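(* Let $n\ge 1$ and $\gamma>0$. Let $f$ be an analytic function on $\mathbb{B}_n$ and let $\varphi$ be an analytic self-map of $\mathbb{B}_n$ that fixes a point $p\in\mathbb{B}_n$. If $W_{f,\varphi}$ is a non-zero normal operator on $H_\gamma$, then there exist a complex constant $\alpha\neq 0$ and a normal linear operator $A$ on $\mathbb{C}^n$ with $\|A\|\leq 1$ such that $$f=\alpha\,\frac{k^{\gamma}_p}{k^{\gamma}_p\circ\varphi}\quad\text{and}\quad \varphi(z)=\varphi_p(A\varphi_p(z))\ \text{ for } z\in\mathbb{B}_n. \qquad ( * )$$ Conversely, if $f$ and $\varphi$ satisfy $( * )$ for some constant $\alpha\ne 0$ and some normal linear operator $A$ on $\mathbb{C}^n$ with $\|A\|\le 1$, then $\alpha=f(p)$ and $W_{f,\varphi}$ is unitarily equivalent to the normal operator $f(p)C_{A}$ (in fact, $W_{f,\varphi}=U_{p}\big(f(p)C_{A}\big)U_{p}$), and hence it is normal.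
   Context: $\mathbb{B}_n$ is the open unit ball of $\mathbb{C}^n$, with $\langle z,w\rangle=\sum_j z_j\overline{w_j}$. For $\gamma>0$, $H_{\gamma}$ is the Hilbert space of analytic functions on $\mathbb{B}_n$ with reproducing kernel $K^{\gamma}_z(w)=(1-\langle w,z\rangle)^{-\gamma}$ (principal branch). For $a\in\mathbb{B}_n$, $k^{\gamma}_a(w)=K^\gamma_a(w)/\|K^\gamma_a\|=(1-|a|^2)^{\gamma/2}(1-\langle w,a\rangle)^{-\gamma}$. For $f$ analytic on $\mathbb{B}_n$ and $\varphi$ an analytic self-map of $\mathbb{B}_n$, $W_{f,\varphi}h=f\cdot(h\circ\varphi)$; saying that it is normal on $H_\gamma$ includes that it is a bounded operator on $H_\gamma$. For a linear operator $A$ on $\mathbb{C}^n$ with $\|A\|\le1$, $C_A$ is the (bounded) composition operator $(C_Ah)(z)=h(Az)$ on $H_\gamma$. For $a\in\mathbb{B}_n$, $\varphi_a$ is the Moebius involution of $\mathbb{B}_n$ interchanging $0$ and $a$: $\varphi_0(z)=-z$ and, for $a\ne0$, $\varphi_a(z)=\dfrac{a-P_az-\sqrt{1-|a|^2}\,(z-P_az)}{1-\langle z,a\rangle}$ where $P_az=\frac{\langle z,a\rangle}{|a|^2}a$; it satisfies $\varphi_a\circ\varphi_a=\mathrm{id}$. Finally $U_a=W_{k^\gamma_a,\varphi_a}$, a self-adjoint unitary operator on $H_\gamma$. *)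

theory Defs
  imports "HOL-Analysis.Analysis"
begin

section \<open>Complex Euclidean space\<close>

definition hdot :: "complex ^ 'n \<Rightarrow> complex ^ 'n \<Rightarrow> complex" where
  "hdot z w = (\<Sum>j\<in>UNIV. z $ j * cnj (w $ j))"

definition normal_linear :: "(complex ^ 'n \<Rightarrow> complex ^ 'n) \<Rightarrow> bool" where
  "normal_linear A \<longleftrightarrow>
     Vector_Spaces.linear (*s) (*s) A \<and>
     (\<exists>B. Vector_Spaces.linear (*s) (*s) B \<and>
          (\<forall>z w. hdot (A z) w = hdot z (B w)) \<and>
          A \<circ> B = B \<circ> A)"


section \<open>Analytic functions on the unit ball\<close>

abbreviation unit_ball :: "(complex ^ 'n) set" where
  "unit_ball \<equiv> ball 0 1"

text \<open>Analyticity in several variables is complex differentiability: the real Frechet derivative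
  exists at every point and is complex linear.\<close>

definition analytic_on_ball :: "(complex ^ 'n \<Rightarrow> complex) \<Rightarrow> bool" where
  "analytic_on_ball f \<longleftrightarrow>
     (\<forall>z\<in>unit_ball. \<exists>D. (f has_derivative D) (at z) \<and> (\<forall>c v. D (c *s v) = c * D v))"

definition analytic_self_map :: "(complex ^ 'n \<Rightarrow> complex ^ 'n) \<Rightarrow> bool" where
  "analytic_self_map \<phi> \<longleftrightarrow>
     (\<forall>i. analytic_on_ball (\<lambda>z. \<phi> z $ i)) \<and> (\<forall>z\<in>unit_ball. \<phi> z \<in> unit_ball)"

text \<open>The elements of the function spaces below are functions on the ball. They are represented
  by total functions that vanish off the ball, so that equality of representatives is equality
  on the ball and the vector space operations are pointwise.\<close>

definition on_ball :: "(complex ^ 'n \<Rightarrow> complex) \<Rightarrow> complex ^ 'n \<Rightarrow> complex" where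
  "on_ball h = (\<lambda>z. if z \<in> unit_ball then h z else 0)"


section \<open>Hilbert spaces of functions and their operators\<close>

definition hnorm :: "(('a \<Rightarrow> complex) \<Rightarrow> ('a \<Rightarrow> complex) \<Rightarrow> complex) \<Rightarrow> ('a \<Rightarrow> complex) \<Rightarrow> real" where
  "hnorm ip h = sqrt (Re (ip h h))"

locale hilbert_function_space =
  fixes H :: "('a \<Rightarrow> complex) set"
    and ip :: "('a \<Rightarrow> complex) \<Rightarrow> ('a \<Rightarrow> complex) \<Rightarrow> complex"
  assumes zero_mem: "(\<lambda>_. 0) \<in> H"
    and add_mem: "\<And>g h. g \<in> H \<Longrightarrow> h \<in> H \<Longrightarrow> (\<lambda>x. g x + h x) \<in> H"
    and scale_mem: "\<And>c h. h \<in> H \<Longrightarrow> (\<lambda>x. c * h x) \<in> H"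
    and ip_add: "\<And>g h k. g \<in> H \<Longrightarrow> h \<in> H \<Longrightarrow> k \<in> H \<Longrightarrow>
                   ip (\<lambda>x. g x + h x) k = ip g k + ip h k"
    and ip_scale: "\<And>c g h. g \<in> H \<Longrightarrow> h \<in> H \<Longrightarrow> ip (\<lambda>x. c * g x) h = c * ip g h"
    and ip_commute: "\<And>g h. g \<in> H \<Longrightarrow> h \<in> H \<Longrightarrow> ip g h = cnj (ip h g)"
    and ip_pos: "\<And>h. h \<in> H \<Longrightarrow> h \<noteq> (\<lambda>_. 0) \<Longrightarrow> 0 < Re (ip h h)"
    and complete: "\<And>X :: nat \<Rightarrow> 'a \<Rightarrow> complex.
          (\<And>n. X n \<in> H) \<Longrightarrow>
          (\<forall>e>0. \<exists>N. \<forall>m\<ge>N. \<forall>n\<ge>N. hnorm ip (\<lambda>x. X m x - X n x) < e) \<Longrightarrow>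
          \<exists>L\<in>H. (\<lambda>n. hnorm ip (\<lambda>x. X n x - L x)) \<longlonglongrightarrow> 0"

definition bounded_operator ::
  "('a \<Rightarrow> complex) set \<Rightarrow> (('a \<Rightarrow> complex) \<Rightarrow> ('a \<Rightarrow> complex) \<Rightarrow> complex) \<Rightarrow>
   (('a \<Rightarrow> complex) \<Rightarrow> 'a \<Rightarrow> complex) \<Rightarrow> bool" where
  "bounded_operator H ip T \<longleftrightarrow>
     (\<forall>h\<in>H. T h \<in> H) \<and>
     (\<forall>g\<in>H. \<forall>h\<in>H. T (\<lambda>x. g x + h x) = (\<lambda>x. T g x + T h x)) \<and>
     (\<forall>c. \<forall>h\<in>H. T (\<lambda>x. c * h x) = (\<lambda>x. c * T h x)) \<and>
     (\<exists>C. \<forall>h\<in>H. hnorm ip (T h) \<le> C * hnorm ip h)"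

definition normal_operator ::
  "('a \<Rightarrow> complex) set \<Rightarrow> (('a \<Rightarrow> complex) \<Rightarrow> ('a \<Rightarrow> complex) \<Rightarrow> complex) \<Rightarrow>
   (('a \<Rightarrow> complex) \<Rightarrow> 'a \<Rightarrow> complex) \<Rightarrow> bool" where
  "normal_operator H ip T \<longleftrightarrow>
     bounded_operator H ip T \<and>
     (\<exists>S. bounded_operator H ip S \<and>
          (\<forall>g\<in>H. \<forall>h\<in>H. ip (T g) h = ip g (S h)) \<and>
          (\<forall>h\<in>H. T (S h) = S (T h)))"

definition unitary_operator ::
  "('a \<Rightarrow> complex) set \<Rightarrow> (('a \<Rightarrow> complex) \<Rightarrow> ('a \<Rightarrow> complex) \<Rightarrow> complex) \<Rightarrow>
   (('a \<Rightarrow> complex) \<Rightarrow> 'a \<Rightarrow> complex) \<Rightarrow> bool" where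
  "unitary_operator H ip U \<longleftrightarrow>
     bounded_operator H ip U \<and> U ` H = H \<and> (\<forall>g\<in>H. \<forall>h\<in>H. ip (U g) (U h) = ip g h)"

definition unitarily_equivalent ::
  "('a \<Rightarrow> complex) set \<Rightarrow> (('a \<Rightarrow> complex) \<Rightarrow> ('a \<Rightarrow> complex) \<Rightarrow> complex) \<Rightarrow>
   (('a \<Rightarrow> complex) \<Rightarrow> 'a \<Rightarrow> complex) \<Rightarrow> (('a \<Rightarrow> complex) \<Rightarrow> 'a \<Rightarrow> complex) \<Rightarrow> bool" where
  "unitarily_equivalent H ip T S \<longleftrightarrow>
     (\<exists>U. unitary_operator H ip U \<and> (\<forall>h\<in>H. T (U h) = U (S h)))"


section \<open>The space with kernel \<open>(1 - hdot w z) powr (- \<gamma>)\<close>\<close>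

definition kern :: "real \<Rightarrow> complex ^ 'n \<Rightarrow> complex ^ 'n \<Rightarrow> complex" where
  "kern \<gamma> z = on_ball (\<lambda>w. (1 - hdot w z) powr (- complex_of_real \<gamma>))"

text \<open>A Hilbert space of functions is determined, as a set and including its inner product, by its
  reproducing kernel. Hence at most one \<open>H\<close>, with its inner product on \<open>H\<close>, satisfies the following
  for a given \<open>\<gamma>\<close>.\<close>

locale kernel_space = hilbert_function_space H ip
  for \<gamma> :: real
    and H :: "(complex ^ 'n \<Rightarrow> complex) set"
    and ip :: "(complex ^ 'n \<Rightarrow> complex) \<Rightarrow> (complex ^ 'n \<Rightarrow> complex) \<Rightarrow> complex" +
  assumes analytic: "\<And>h. h \<in> H \<Longrightarrow> analytic_on_ball h"
    and zero_off_ball: "\<And>h z. h \<in> H \<Longrightarrow> z \<notin> unit_ball \<Longrightarrow> h z = 0"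
    and kern_mem: "\<And>z. z \<in> unit_ball \<Longrightarrow> kern \<gamma> z \<in> H"
    and reproducing: "\<And>h z. h \<in> H \<Longrightarrow> z \<in> unit_ball \<Longrightarrow> h z = ip h (kern \<gamma> z)"

definition nkern :: "real \<Rightarrow> complex ^ 'n \<Rightarrow> complex ^ 'n \<Rightarrow> complex" where
  "nkern \<gamma> a = on_ball (\<lambda>w. complex_of_real ((1 - (norm a)\<^sup>2) powr (\<gamma> / 2)) *
                              (1 - hdot w a) powr (- complex_of_real \<gamma>))"

lemma hdot_self: "hdot z z = complex_of_real ((norm z)\<^sup>2)"
  by (simp add: hdot_def norm_vec_def L2_set_def sum_nonneg flip: complex_norm_square)

lemma (in kernel_space) nkern_eq:
  assumes "a \<in> unit_ball"
  shows "nkern \<gamma> a = (\<lambda>w. kern \<gamma> a w / complex_of_real (hnorm ip (kern \<gamma> a)))"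
proof -
  have lt: "0 < 1 - (norm a)\<^sup>2"
    using assms by (simp add: power_less_one_iff abs_square_less_1)
  have "ip (kern \<gamma> a) (kern \<gamma> a) = kern \<gamma> a a"
    using assms kern_mem reproducing by metis
  also have "\<dots> = complex_of_real (1 - (norm a)\<^sup>2) powr complex_of_real (- \<gamma>)"
    using assms by (simp add: kern_def on_ball_def hdot_self)
  also have "\<dots> = complex_of_real ((1 - (norm a)\<^sup>2) powr (- \<gamma>))"
    using lt by (simp only: powr_of_real less_imp_le)
  finally have "hnorm ip (kern \<gamma> a) = sqrt ((1 - (norm a)\<^sup>2) powr (- \<gamma>))"
    by (simp add: hnorm_def)
  also have "\<dots> = (1 - (norm a)\<^sup>2) powr (- (\<gamma> / 2))"
  proof (rule real_sqrt_unique)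
    have "((1 - (norm a)\<^sup>2) powr (- (\<gamma> / 2)))\<^sup>2 =
        (1 - (norm a)\<^sup>2) powr (- (\<gamma> / 2) + - (\<gamma> / 2))"
      unfolding power2_eq_square by (rule powr_add[symmetric])
    then show "((1 - (norm a)\<^sup>2) powr (- (\<gamma> / 2)))\<^sup>2 = (1 - (norm a)\<^sup>2) powr (- \<gamma>)"
      by (simp only: minus_add_distrib[symmetric] field_sum_of_halves)
  qed (rule powr_ge_zero)
  also have "\<dots> = inverse ((1 - (norm a)\<^sup>2) powr (\<gamma> / 2))"
    by (rule powr_minus)
  finally have norm_eq: "hnorm ip (kern \<gamma> a) = inverse ((1 - (norm a)\<^sup>2) powr (\<gamma> / 2))" .
  have "u / inverse v = v * u" for u v :: complex
    by (metis divide_inverse inverse_inverse_eq mult.commute)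
  then show ?thesis
    unfolding norm_eq by (intro ext) (simp add: nkern_def kern_def on_ball_def)
qed


section \<open>Moebius involutions and weighted composition operators\<close>

definition proj :: "complex ^ 'n \<Rightarrow> complex ^ 'n \<Rightarrow> complex ^ 'n" where
  "proj a z = (hdot z a / complex_of_real ((norm a)\<^sup>2)) *s a"

definition moebius :: "complex ^ 'n \<Rightarrow> complex ^ 'n \<Rightarrow> complex ^ 'n" where
  "moebius a z =
     (if a = 0 then - z
      else (1 / (1 - hdot z a)) *s (a - proj a z - sqrt (1 - (norm a)\<^sup>2) *\<^sub>R (z - proj a z)))"

definition wcomp ::
  "(complex ^ 'n \<Rightarrow> complex) \<Rightarrow> (complex ^ 'n \<Rightarrow> complex ^ 'n) \<Rightarrow>
   (complex ^ 'n \<Rightarrow> complex) \<Rightarrow> complex ^ 'n \<Rightarrow> complex" where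
  "wcomp f \<phi> h = on_ball (\<lambda>z. f z * h (\<phi> z))"

definition comp_op ::
  "(complex ^ 'n \<Rightarrow> complex ^ 'n) \<Rightarrow> (complex ^ 'n \<Rightarrow> complex) \<Rightarrow> complex ^ 'n \<Rightarrow> complex" where
  "comp_op A h = on_ball (\<lambda>z. h (A z))"

definition moebius_op ::
  "real \<Rightarrow> complex ^ 'n \<Rightarrow> (complex ^ 'n \<Rightarrow> complex) \<Rightarrow> complex ^ 'n \<Rightarrow> complex" where
  "moebius_op \<gamma> a = wcomp (nkern \<gamma> a) (moebius a)"

definition moebius_linear_form ::
  "real \<Rightarrow> complex ^ 'n \<Rightarrow> (complex ^ 'n \<Rightarrow> complex) \<Rightarrow> (complex ^ 'n \<Rightarrow> complex ^ 'n) \<Rightarrow>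
   complex \<Rightarrow> (complex ^ 'n \<Rightarrow> complex ^ 'n) \<Rightarrow> bool" where
  "moebius_linear_form \<gamma> p f \<phi> \<alpha> A \<longleftrightarrow>
     (\<forall>z\<in>unit_ball. f z = \<alpha> * (nkern \<gamma> p z / nkern \<gamma> p (\<phi> z))) \<and>
     (\<forall>z\<in>unit_ball. \<phi> z = moebius p (A (moebius p z)))"

end

theory Submission
  imports Defs
begin

text \<open>
  If \<open>W = wcomp f \<phi>\<close> is normal, then \<open>W\<^sup>* K\<^sub>p = cnj (f p) K\<^sub>p\<close> because \<open>\<phi> p = p\<close>, so normality gives
  \<open>W K\<^sub>p = f p K\<^sub>p\<close>, which is the formula for \<open>f\<close>. Conjugation with the self-adjoint unitary
  \<open>U\<^sub>p\<close> then turns \<open>W\<close> into \<open>f p\<close> times composition with \<open>\<psi> = \<phi>\<^sub>p \<circ> \<phi> \<circ> \<phi>\<^sub>p\<close>, which fixes the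
  origin. The adjoint of a composition operator fixing the origin leaves the
  finite-dimensional space of linear functions invariant; comparing Hilbert-Schmidt norms there shows
  that the normal operator itself leaves it invariant, so \<open>\<psi>\<close> is linear.

  Conversely, \<open>W = U\<^sub>p (f p C\<^sub>A) U\<^sub>p\<close> is a direct computation. That \<open>U\<^sub>p\<close> and \<open>C\<^sub>A\<close> are bounded is a
  matter of positive semidefinite kernels: for \<open>C\<^sub>A\<close> one expands \<open>(1 - x) powr (- \<gamma>)\<close> in powers of
  \<open>x\<close> with positive coefficients. The adjoint of \<open>C\<^sub>A\<close> is composition with the adjoint matrix.
\<close>

section \<open>Hilbert spaces of functions\<close>


text \<open>The space \<open>H\<close> is given only by its axioms, without a monomial basis or an
  integral formula, so every fact about it has to be extracted from \<open>kern\<close>. For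
  boundedness, the obstacle is already that \<open>wcomp f \<phi> h\<close> must be shown to lie in
  \<open>H\<close>. The way around is duality: an operator given by a formula, acting on kernels as
  the adjoint should, is estimated on finite sums of kernels, where contractivity is positive
  semidefiniteness of a difference of kernels. Then \<open>riesz\<close> produces a vector of
  \<open>H\<close>, and testing it against kernels identifies it with
  \<open>wcomp f \<phi> h\<close>. For the same reason linear functions enter \<open>H\<close> as
  limits of kernels; pairing with them differentiates at the origin. The Hilbert-Schmidt comparison
  compensates for the lack of control at a single vector: the squared distance of
  \<open>T (lin_fun a)\<close> from its projection is proportional to
  \<open>(norm (B a))\<^sup>2 - (norm (B' a))\<^sup>2\<close>. Each such term is nonnegative, being
  a squared norm, and their sum over the standard basis is zero, so each vanishes. This is where
  finite dimension enters.\<close>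

context hilbert_function_space
begin

lemma minus_mem: "h \<in> H \<Longrightarrow> (\<lambda>x. - h x) \<in> H"
  using scale_mem[of h "-1"] by simp

lemma diff_mem: "g \<in> H \<Longrightarrow> h \<in> H \<Longrightarrow> (\<lambda>x. g x - h x) \<in> H"
  using add_mem[of g "\<lambda>x. - h x"] minus_mem[of h] by simp

lemma ip_minus: "g \<in> H \<Longrightarrow> h \<in> H \<Longrightarrow> ip (\<lambda>x. - g x) h = - ip g h"
  using ip_scale[of g h "-1"] by simp

lemma ip_diff:
  "g \<in> H \<Longrightarrow> h \<in> H \<Longrightarrow> k \<in> H \<Longrightarrow> ip (\<lambda>x. g x - h x) k = ip g k - ip h k"
  using ip_add[of g "\<lambda>x. - h x" k] by (simp add: minus_mem ip_minus)

lemma ip_add_right: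
  assumes "g \<in> H" "h \<in> H" "k \<in> H"
  shows "ip k (\<lambda>x. g x + h x) = ip k g + ip k h"
proof -
  have "ip k (\<lambda>x. g x + h x) = cnj (ip (\<lambda>x. g x + h x) k)"
    using assms by (intro ip_commute add_mem)
  then show ?thesis
    using ip_commute[of k g] ip_commute[of k h] assms by (simp add: ip_add)
qed

lemma ip_scale_right:
  assumes "g \<in> H" "h \<in> H"
  shows "ip h (\<lambda>x. c * g x) = cnj c * ip h g"
proof -
  have "ip h (\<lambda>x. c * g x) = cnj (ip (\<lambda>x. c * g x) h)"
    using assms by (intro ip_commute scale_mem)
  then show ?thesis
    using ip_commute[of h g] assms by (simp add: ip_scale)
qed

lemma ip_diff_right:
  assumes "g \<in> H" "h \<in> H" "k \<in> H"
  shows "ip k (\<lambda>x. g x - h x) = ip k g - ip k h"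
proof -
  have "ip k (\<lambda>x. g x - h x) = cnj (ip (\<lambda>x. g x - h x) k)"
    using assms by (intro ip_commute diff_mem)
  then show ?thesis
    using ip_commute[of k g] ip_commute[of k h] assms by (simp add: ip_diff)
qed

lemma ip_zero: "h \<in> H \<Longrightarrow> ip (\<lambda>_. 0) h = 0"
  using ip_scale[of h h 0] by simp

lemma ip_zero_right: "h \<in> H \<Longrightarrow> ip h (\<lambda>_. 0) = 0"
  using ip_scale_right[of h h 0] by simp

lemma sum_mem:
  assumes "finite S" "\<And>i. i \<in> S \<Longrightarrow> g i \<in> H"
  shows "(\<lambda>x. \<Sum>i\<in>S. g i x) \<in> H"
  using assms by (induction S rule: finite_induct) (simp_all add: zero_mem add_mem)

lemma ip_sum:
  assumes "finite S" "\<And>i. i \<in> S \<Longrightarrow> g i \<in> H" "h \<in> H"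
  shows "ip (\<lambda>x. \<Sum>i\<in>S. g i x) h = (\<Sum>i\<in>S. ip (g i) h)"
  using assms
  by (induction S rule: finite_induct) (simp_all add: ip_zero ip_add sum_mem)

lemma ip_sum_right:
  assumes "finite S" "\<And>i. i \<in> S \<Longrightarrow> g i \<in> H" "h \<in> H"
  shows "ip h (\<lambda>x. \<Sum>i\<in>S. g i x) = (\<Sum>i\<in>S. ip h (g i))"
  using assms
  by (induction S rule: finite_induct) (simp_all add: ip_zero_right ip_add_right sum_mem)

lemma ip_self_nonneg: "h \<in> H \<Longrightarrow> 0 \<le> Re (ip h h)"
  by (cases "h = (\<lambda>_. 0)") (auto simp: ip_zero dest: ip_pos)

lemma hnorm_nonneg: "h \<in> H \<Longrightarrow> 0 \<le> hnorm ip h"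
  by (simp add: hnorm_def ip_self_nonneg)

lemma hnorm_sq: "h \<in> H \<Longrightarrow> (hnorm ip h)\<^sup>2 = Re (ip h h)"
  by (simp add: hnorm_def ip_self_nonneg)

lemma ip_self:
  assumes "h \<in> H"
  shows "ip h h = complex_of_real ((hnorm ip h)\<^sup>2)"
proof -
  have "Im (ip h h) = 0"
    using arg_cong[OF ip_commute[OF assms assms], of Im] by simp
  then show ?thesis
    by (simp add: hnorm_sq[OF assms] complex_eq_iff)
qed

lemma hnorm_eq_0D: "h \<in> H \<Longrightarrow> hnorm ip h = 0 \<Longrightarrow> h = (\<lambda>_. 0)"
  using ip_pos[of h] by (auto simp: hnorm_def)

lemma hnorm_scale:
  assumes "h \<in> H"
  shows "hnorm ip (\<lambda>x. c * h x) = cmod c * hnorm ip h"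
proof -
  have "ip (\<lambda>x. c * h x) (\<lambda>x. c * h x) = (c * cnj c) * ip h h"
    using assms by (simp add: ip_scale ip_scale_right scale_mem)
  also have "\<dots> = complex_of_real ((cmod c * hnorm ip h)\<^sup>2)"
    using assms by (simp add: ip_self power_mult_distrib flip: complex_norm_square)
  finally show ?thesis
    using hnorm_nonneg[OF assms] by (simp add: hnorm_def)
qed

lemma hnorm_add_sq:
  assumes "g \<in> H" "h \<in> H"
  shows "(hnorm ip (\<lambda>x. g x + h x))\<^sup>2 = (hnorm ip g)\<^sup>2 + 2 * Re (ip g h) + (hnorm ip h)\<^sup>2"
  using assms ip_commute[of h g]
  by (simp add: hnorm_sq add_mem ip_add ip_add_right)

lemma hnorm_diff_sq:
  assumes "g \<in> H" "h \<in> H"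
  shows "(hnorm ip (\<lambda>x. g x - h x))\<^sup>2 = (hnorm ip g)\<^sup>2 - 2 * Re (ip g h) + (hnorm ip h)\<^sup>2"
  using assms ip_commute[of h g]
  by (simp add: hnorm_sq diff_mem ip_diff ip_diff_right)

lemma cauchy_schwarz:
  assumes g: "g \<in> H" and h: "h \<in> H"
  shows "cmod (ip g h) \<le> hnorm ip g * hnorm ip h"
proof (cases "hnorm ip h = 0")
  case True
  then show ?thesis
    using hnorm_eq_0D[OF h True] g by (simp add: ip_zero_right)
next
  case False
  define N where "N = (hnorm ip h)\<^sup>2"
  have N: "N > 0" using False by (simp add: N_def)
  define c where "c = ip g h / N"
  have "0 \<le> (hnorm ip (\<lambda>x. g x - c * h x))\<^sup>2" by simp
  also have "\<dots> = (hnorm ip g)\<^sup>2 - 2 * Re (cnj c * ip g h) + (cmod c)\<^sup>2 * N"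
    using g h by (simp add: hnorm_diff_sq scale_mem ip_scale_right hnorm_scale power_mult_distrib N_def)
  also have "cnj c * ip g h = complex_of_real ((cmod (ip g h))\<^sup>2 / N)"
    using complex_norm_square[of "ip g h"] by (simp add: c_def mult.commute)
  also have "(cmod c)\<^sup>2 * N = (cmod (ip g h))\<^sup>2 / N"
    using N by (simp add: c_def norm_divide power_divide power2_eq_square)
  finally have "(cmod (ip g h))\<^sup>2 / N \<le> (hnorm ip g)\<^sup>2"
    by simp
  then have "(cmod (ip g h))\<^sup>2 \<le> (hnorm ip g * hnorm ip h)\<^sup>2"
    using N by (simp add: field_simps N_def)
  then show ?thesis
    by (rule power2_le_imp_le) (simp add: g h hnorm_nonneg)
qed

lemma hnorm_triangle_diff:
  assumes g: "g \<in> H" and h: "h \<in> H"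
  shows "\<bar>hnorm ip g - hnorm ip h\<bar> \<le> hnorm ip (\<lambda>x. g x - h x)"
proof -
  have "Re (ip g h) \<le> hnorm ip g * hnorm ip h"
    using cauchy_schwarz[OF g h] complex_Re_le_cmod order_trans by blast
  then have "\<bar>hnorm ip g - hnorm ip h\<bar>\<^sup>2 \<le> (hnorm ip (\<lambda>x. g x - h x))\<^sup>2"
    by (simp add: hnorm_diff_sq[OF g h] power2_diff)
  then show ?thesis
    by (rule power2_le_imp_le) (simp add: g h hnorm_nonneg diff_mem)
qed

lemma tendsto_ip:
  assumes X: "\<And>n. X n \<in> H" and L: "L \<in> H" and h: "h \<in> H"
    and lim: "(\<lambda>n. hnorm ip (\<lambda>x. X n x - L x)) \<longlonglongrightarrow> 0"
  shows "(\<lambda>n. ip (X n) h) \<longlonglongrightarrow> ip L h"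
proof -
  have "(\<lambda>n. hnorm ip (\<lambda>x. X n x - L x) * hnorm ip h) \<longlonglongrightarrow> 0"
    using tendsto_mult_right[OF lim, of "hnorm ip h"] by simp
  then have "(\<lambda>n. ip (\<lambda>x. X n x - L x) h) \<longlonglongrightarrow> 0"
    by (rule Lim_null_comparison[rotated]) (simp add: X L h cauchy_schwarz diff_mem)
  then show ?thesis
    by (simp add: ip_diff X L h LIM_zero_iff)
qed

lemma tendsto_ip_right:
  assumes "\<And>n. X n \<in> H" "L \<in> H" "h \<in> H"
    and "(\<lambda>n. hnorm ip (\<lambda>x. X n x - L x)) \<longlonglongrightarrow> 0"
  shows "(\<lambda>n. ip h (X n)) \<longlonglongrightarrow> ip h L"
proof -
  have "(\<lambda>n. cnj (ip (X n) h)) \<longlonglongrightarrow> cnj (ip L h)"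
    using tendsto_ip[OF assms] by (rule tendsto_cnj)
  moreover have "cnj (ip (X n) h) = ip h (X n)" for n
    using assms ip_commute[of h "X n"] by simp
  moreover have "cnj (ip L h) = ip h L"
    using assms ip_commute[of h L] by simp
  ultimately show ?thesis by simp
qed

lemma tendsto_hnorm:
  assumes "\<And>n. X n \<in> H" "L \<in> H"
    and "(\<lambda>n. hnorm ip (\<lambda>x. X n x - L x)) \<longlonglongrightarrow> 0"
  shows "(\<lambda>n. hnorm ip (X n)) \<longlonglongrightarrow> hnorm ip L"
proof -
  have "(\<lambda>n. hnorm ip (X n) - hnorm ip L) \<longlonglongrightarrow> 0"
    by (rule Lim_null_comparison[OF _ assms(3)]) (simp add: hnorm_triangle_diff assms)
  then show ?thesis by (simp add: LIM_zero_iff)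
qed

text \<open>The representing vector is the limit of a minimizing sequence of
  \<open>\<parallel>u\<parallel>\<^sup>2 - 2 Re (l u)\<close>.\<close>

lemma riesz:
  assumes D: "D \<subseteq> H" and D0: "(\<lambda>_. 0) \<in> D"
    and Dadd: "\<And>u v. u \<in> D \<Longrightarrow> v \<in> D \<Longrightarrow> (\<lambda>x. u x + v x) \<in> D"
    and Dscale: "\<And>c u. u \<in> D \<Longrightarrow> (\<lambda>x. c * u x) \<in> D"
    and ladd: "\<And>u v. u \<in> D \<Longrightarrow> v \<in> D \<Longrightarrow> l (\<lambda>x. u x + v x) = l u + l v"
    and lscale: "\<And>c u. u \<in> D \<Longrightarrow> l (\<lambda>x. c * u x) = c * l u"
    and M: "0 \<le> M" and bound: "\<And>u. u \<in> D \<Longrightarrow> cmod (l u) \<le> M * hnorm ip u"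
  shows "\<exists>g\<in>H. hnorm ip g \<le> M \<and> (\<forall>u\<in>D. l u = ip u g)"
proof -
  define F where "F u = (hnorm ip u)\<^sup>2 - 2 * Re (l u)" for u
  define I where "I = Inf (F ` D)"
  have DH: "u \<in> H" if "u \<in> D" for u using that D by blast
  have F_ge: "- M\<^sup>2 \<le> F u" if "u \<in> D" for u
  proof -
    have "Re (l u) \<le> M * hnorm ip u"
      using bound[OF that] complex_Re_le_cmod order_trans by blast
    moreover have "0 \<le> (hnorm ip u - M)\<^sup>2" by simp
    ultimately show ?thesis by (simp add: F_def power2_diff mult.commute)
  qed
  then have bdd: "bdd_below (F ` D)" by (intro bdd_belowI2)
  have I_le: "I \<le> F u" if "u \<in> D" for u
    unfolding I_def using that bdd by (rule cINF_lower[rotated])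
  have "\<exists>u\<in>D. F u < I + 1 / real (Suc n)" for n
  proof -
    have "Inf (F ` D) < I + 1 / real (Suc n)" by (simp add: I_def)
    then show ?thesis using D0 bdd by (subst (asm) cINF_less_iff) auto
  qed
  then obtain X where X: "\<And>n. X n \<in> D" and FX: "\<And>n. F (X n) < I + 1 / real (Suc n)"
    by metis
  have XH: "X n \<in> H" for n using X DH by blast
  \<comment> \<open>Parallelogram law: the midpoint \<open>w\<close> lies in \<open>D\<close>, so
    its value of \<open>F\<close> is at least \<open>I\<close>. Near-minimizers are therefore close
    to each other.\<close>
  have sq: "(hnorm ip (\<lambda>x. u x - v x))\<^sup>2 \<le> 2 * F u + 2 * F v - 4 * I"
    if "u \<in> D" "v \<in> D" for u v
  proof -
    define w where "w = (\<lambda>x. (1/2) * (u x + v x))"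
    have w: "w \<in> D" unfolding w_def using that by (intro Dscale Dadd)
    have "(hnorm ip w)\<^sup>2 = ((hnorm ip u)\<^sup>2 + 2 * Re (ip u v) + (hnorm ip v)\<^sup>2) / 4"
      unfolding w_def hnorm_scale[OF add_mem[OF that[THEN DH]]] power_mult_distrib
        hnorm_add_sq[OF that[THEN DH]]
      by (simp add: power_divide)
    moreover have "Re (l w) = (Re (l u) + Re (l v)) / 2"
      using that by (simp only: w_def lscale[OF Dadd] ladd) simp
    ultimately have "(hnorm ip (\<lambda>x. u x - v x))\<^sup>2 = 2 * F u + 2 * F v - 4 * F w"
      using that by (simp add: F_def hnorm_diff_sq DH field_simps)
    then show ?thesis using I_le[OF w] by linarith
  qed
  have cauchy: "\<forall>e>0. \<exists>N. \<forall>m\<ge>N. \<forall>n\<ge>N. hnorm ip (\<lambda>x. X m x - X n x) < e"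
  proof (intro allI impI)
    fix e :: real assume e: "e > 0"
    obtain N where N: "1 / real (Suc N) < e\<^sup>2 / 4"
      using e reals_Archimedean[of "e\<^sup>2 / 4"] by (auto simp: inverse_eq_divide)
    show "\<exists>N. \<forall>m\<ge>N. \<forall>n\<ge>N. hnorm ip (\<lambda>x. X m x - X n x) < e"
    proof (intro exI[of _ N] allI impI)
      fix m n assume mn: "N \<le> m" "N \<le> n"
      have le: "F (X k) - I < e\<^sup>2 / 4" if "N \<le> k" for k
      proof -
        have "1 / real (Suc k) \<le> 1 / real (Suc N)"
          using that by (intro divide_left_mono) auto
        then show ?thesis using FX[of k] N by linarith
      qed
      have "2 * F (X m) + 2 * F (X n) - 4 * I < e\<^sup>2"
        using le[OF mn(1)] le[OF mn(2)] by linarith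
      with sq[OF X X] have "(hnorm ip (\<lambda>x. X m x - X n x))\<^sup>2 < e\<^sup>2"
        by (rule order.strict_trans1)
      then show "hnorm ip (\<lambda>x. X m x - X n x) < e"
        by (rule power2_less_imp_less) (simp add: e less_imp_le)
    qed
  qed
  obtain g where g: "g \<in> H" and lim: "(\<lambda>n. hnorm ip (\<lambda>x. X n x - g x)) \<longlonglongrightarrow> 0"
    using complete[OF XH cauchy] by blast
  \<comment> \<open>First variation: moving the minimizing sequence by \<open>t * v\<close> cannot
    push \<open>F\<close> below \<open>I\<close>. In the limit this gives a quadratic in
    \<open>t\<close>, with no constant term, that is nonnegative for every real \<open>t\<close>, so
    its linear coefficient vanishes.\<close>
  have Re_eq: "Re (l v) = Re (ip v g)" if v: "v \<in> D" for v
  proof -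
    have vH: "v \<in> H" using v by (rule DH)
    define d where "d = Re (ip v g) - Re (l v)"
    have nonneg: "0 \<le> 2 * t * d + t\<^sup>2 * (hnorm ip v)\<^sup>2" for t :: real
    proof -
      have "0 \<le> 1 / real (Suc n) + 2 * t * (Re (ip v (X n)) - Re (l v)) + t\<^sup>2 * (hnorm ip v)\<^sup>2" for n
      proof -
        have tv: "(\<lambda>x. complex_of_real t * v x) \<in> D" using v by (rule Dscale)
        have "I \<le> F (\<lambda>x. X n x + complex_of_real t * v x)"
          using X tv by (intro I_le Dadd)
        also have "\<dots> = F (X n) + 2 * t * (Re (ip v (X n)) - Re (l v)) + t\<^sup>2 * (hnorm ip v)\<^sup>2"
          unfolding F_def hnorm_add_sq[OF XH DH[OF tv]] ladd[OF X tv] lscale[OF v]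
          using ip_commute[of v "X n"]
          by (simp add: ip_scale_right hnorm_scale vH XH power_mult_distrib algebra_simps)
        finally show ?thesis using FX[of n] by linarith
      qed
      moreover have "(\<lambda>n. 1 / real (Suc n) + 2 * t * (Re (ip v (X n)) - Re (l v)) + t\<^sup>2 * (hnorm ip v)\<^sup>2)
          \<longlonglongrightarrow> 0 + 2 * t * d + t\<^sup>2 * (hnorm ip v)\<^sup>2"
        unfolding d_def
        using LIMSEQ_inverse_real_of_nat tendsto_ip_right[OF XH g vH lim]
        by (intro tendsto_intros) (auto simp: inverse_eq_divide)
      ultimately show ?thesis
        by (intro LIMSEQ_le_const[where a = 0]) auto
    qed
    have "d = 0"
    proof (rule ccontr)
      assume "d \<noteq> 0"
      \<comment> \<open>The added 1 keeps the minimizing choice \<open>t = - d / V\<close>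
        meaningful when \<open>v\<close> is zero.\<close>
      define V where "V = (hnorm ip v)\<^sup>2 + 1"
      have V: "V > 0" by (simp add: V_def add_nonneg_pos)
      have "0 \<le> 2 * (- d / V) * d + (- d / V)\<^sup>2 * (hnorm ip v)\<^sup>2" by (rule nonneg)
      also have "\<dots> \<le> 2 * (- d / V) * d + (- d / V)\<^sup>2 * V"
        by (intro add_left_mono mult_left_mono) (auto simp: V_def)
      also have "\<dots> = - d\<^sup>2 / V"
        using V by (simp add: power2_eq_square field_simps)
      finally have "d\<^sup>2 / V \<le> 0" by simp
      moreover have "0 < d\<^sup>2 / V"
        using V \<open>d \<noteq> 0\<close> by (intro divide_pos_pos) auto
      ultimately show False by linarith
    qed
    then show ?thesis by (simp add: d_def)
  qed
  have eq: "l v = ip v g" if v: "v \<in> D" for v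
  proof (rule complex_eqI)
    show "Re (l v) = Re (ip v g)" using v by (rule Re_eq)
    \<comment> \<open>The imaginary part of a number is the real part of its product with
      \<open>- \<i>\<close>.\<close>
    show "Im (l v) = Im (ip v g)"
      using Re_eq[OF Dscale[OF v, of "- \<i>"]]
      unfolding lscale[OF v] ip_scale[OF DH[OF v] g] by simp
  qed
  \<comment> \<open>The vector \<open>g\<close> may lie outside \<open>D\<close>, so the bound on
    \<open>l\<close> is carried to \<open>g\<close> along the sequence \<open>X\<close>.\<close>
  have "hnorm ip g \<le> M"
  proof (cases "hnorm ip g = 0")
    case False
    then have pos: "0 < hnorm ip g" using hnorm_nonneg[OF g] by simp
    have "cmod (ip g g) \<le> M * hnorm ip g"
    proof (rule LIMSEQ_le)
      show "(\<lambda>n. cmod (ip (X n) g)) \<longlonglongrightarrow> cmod (ip g g)"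
        by (intro tendsto_norm tendsto_ip XH g lim)
      show "(\<lambda>n. M * hnorm ip (X n)) \<longlonglongrightarrow> M * hnorm ip g"
        by (intro tendsto_mult_left tendsto_hnorm XH g lim)
      show "\<exists>N. \<forall>n\<ge>N. cmod (ip (X n) g) \<le> M * hnorm ip (X n)"
        using bound[OF X] eq[OF X] by auto
    qed
    then have "hnorm ip g * hnorm ip g \<le> M * hnorm ip g"
      by (simp add: ip_self[OF g] norm_power power2_eq_square norm_mult)
    then show ?thesis using pos by simp
  qed (simp add: M)
  with g eq show ?thesis by blast
qed

end

section \<open>The inner product of complex Euclidean space\<close>

lemma hdot_diff_left: "hdot (x - y) w = hdot x w - hdot y w"
  by (simp add: hdot_def sum_subtractf left_diff_distrib)

lemma hdot_add_left: "hdot (x + y) w = hdot x w + hdot y w"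
  by (simp add: hdot_def sum.distrib distrib_right)

lemma hdot_scale_left: "hdot (c *s x) w = c * hdot x w"
  by (simp add: hdot_def sum_distrib_left mult.assoc)

lemma cnj_hdot: "cnj (hdot x y) = hdot y x"
  by (simp add: hdot_def mult.commute)

lemma hdot_diff_right: "hdot w (x - y) = hdot w x - hdot w y"
  by (simp add: hdot_def sum_subtractf right_diff_distrib)

lemma hdot_add_right: "hdot w (x + y) = hdot w x + hdot w y"
  by (simp add: hdot_def sum.distrib distrib_left)

lemma hdot_scale_right: "hdot w (c *s x) = cnj c * hdot w x"
  by (simp add: hdot_def sum_distrib_left mult_ac)

lemma hdot_zero_left [simp]: "hdot 0 w = 0"
  by (simp add: hdot_def)

lemma hdot_zero_right [simp]: "hdot w 0 = 0"
  by (simp add: hdot_def)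

lemma hdot_sum_left: "hdot (\<Sum>i\<in>S. x i) w = (\<Sum>i\<in>S. hdot (x i) w)"
  by (induction S rule: infinite_finite_induct) (simp_all add: hdot_add_left)

lemma hdot_sum_right: "hdot w (\<Sum>i\<in>S. x i) = (\<Sum>i\<in>S. hdot w (x i))"
  by (induction S rule: infinite_finite_induct) (simp_all add: hdot_add_right)

lemma norm_hdot_le: "cmod (hdot z w) \<le> norm z * norm w"
proof -
  have "cmod (hdot z w) \<le> (\<Sum>j\<in>UNIV. \<bar>cmod (z $ j)\<bar> * \<bar>cmod (w $ j)\<bar>)"
    unfolding hdot_def by (rule order_trans[OF norm_sum]) (simp add: norm_mult)
  also have "\<dots> \<le> norm z * norm w"
    unfolding norm_vec_def by (rule L2_set_mult_ineq)
  finally show ?thesis .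
qed

lemma norm_hdot_less_1:
  assumes "z \<in> unit_ball" "w \<in> unit_ball"
  shows "cmod (hdot z w) < 1"
proof -
  have "norm z * norm w \<le> norm z * 1"
    using assms by (intro mult_left_mono) auto
  then show ?thesis
    using norm_hdot_le[of z w] assms by simp
qed

lemma Re_one_minus_hdot_pos:
  assumes "z \<in> unit_ball" "w \<in> unit_ball"
  shows "0 < Re (1 - hdot z w)"
  using norm_hdot_less_1[OF assms] complex_Re_le_cmod[of "hdot z w"] by simp

lemma hdot_eqI: "(\<And>w. hdot x w = hdot y w) \<Longrightarrow> x = y"
  using hdot_self[of "x - y"] by (simp add: hdot_diff_left)

lemma hdot_eqI_right: "(\<And>w. hdot w x = hdot w y) \<Longrightarrow> x = y"
  by (rule hdot_eqI) (metis cnj_hdot)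

lemma clinear_iff:
  fixes A :: "complex ^ 'n \<Rightarrow> complex ^ 'm"
  shows "Vector_Spaces.linear (*s) (*s) A \<longleftrightarrow>
    (\<forall>x y. A (x + y) = A x + A y) \<and> (\<forall>c x. A (c *s x) = c *s A x)"
  by (simp add: Vector_Spaces.linear_iff vec.vector_space_axioms)

lemma scaleR_eq_scale: "r *\<^sub>R x = complex_of_real r *s x" for x :: "complex ^ 'n"
  by (simp add: vec_eq_iff complex_eq_iff)

lemma clinear_imp_bounded_linear:
  fixes A :: "complex ^ 'n \<Rightarrow> complex ^ 'm"
  assumes "Vector_Spaces.linear (*s) (*s) A"
  shows "bounded_linear A"
  using assms by (intro linear_conv_bounded_linear[THEN iffD1] linearI)
    (simp_all add: clinear_iff scaleR_eq_scale)

section \<open>Positive semidefinite kernels\<close>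

text \<open>The placement of \<open>cnj\<close> is chosen so that for
  \<open>Q = kern \<gamma>\<close> the form is the squared norm of the sum of the
  \<open>c z * kern \<gamma> z\<close>. Since \<open>kern \<gamma> z w\<close> depends on
  \<open>hdot w z\<close>, Gram kernels appear below with their arguments reversed.\<close>

definition psd :: "(complex ^ 'n \<Rightarrow> complex ^ 'n \<Rightarrow> complex) \<Rightarrow> bool" where
  "psd Q \<longleftrightarrow> (\<forall>S c. finite S \<longrightarrow> S \<subseteq> unit_ball \<longrightarrow>
     0 \<le> Re (\<Sum>z\<in>S. \<Sum>w\<in>S. c z * cnj (c w) * Q z w))"

lemma psd_cong:
  fixes P Q :: "complex ^ 'n \<Rightarrow> complex ^ 'n \<Rightarrow> complex"
  assumes "psd P" "\<And>z w. z \<in> unit_ball \<Longrightarrow> w \<in> unit_ball \<Longrightarrow> P z w = Q z w"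
  shows "psd Q"
  unfolding psd_def
proof (intro allI impI)
  fix S c assume S: "finite S" "S \<subseteq> (unit_ball :: (complex ^ 'n) set)"
  have "(\<Sum>z\<in>S. \<Sum>w\<in>S. c z * cnj (c w) * Q z w) = (\<Sum>z\<in>S. \<Sum>w\<in>S. c z * cnj (c w) * P z w)"
    using S by (intro sum.cong refl) (metis assms(2) subsetD)
  then show "0 \<le> Re (\<Sum>z\<in>S. \<Sum>w\<in>S. c z * cnj (c w) * Q z w)"
    using assms(1) S by (simp add: psd_def)
qed

lemma psd_zero: "psd (\<lambda>z w. 0)"
  by (simp add: psd_def)

lemma psd_add:
  assumes "psd P" "psd Q"
  shows "psd (\<lambda>z w. P z w + Q z w)"
  using assms by (simp add: psd_def distrib_left sum.distrib add_nonneg_nonneg del: Re_sum)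

lemma psd_scale:
  fixes P :: "complex ^ 'n \<Rightarrow> complex ^ 'n \<Rightarrow> complex"
  assumes "psd P" "0 \<le> r"
  shows "psd (\<lambda>z w. complex_of_real r * P z w)"
  unfolding psd_def
proof (intro allI impI)
  fix S c assume S: "finite S" "S \<subseteq> (unit_ball :: (complex ^ 'n) set)"
  have "(\<Sum>z\<in>S. \<Sum>w\<in>S. c z * cnj (c w) * (complex_of_real r * P z w)) =
      complex_of_real r * (\<Sum>z\<in>S. \<Sum>w\<in>S. c z * cnj (c w) * P z w)"
    by (simp add: sum_distrib_left mult_ac)
  then show "0 \<le> Re (\<Sum>z\<in>S. \<Sum>w\<in>S. c z * cnj (c w) * (complex_of_real r * P z w))"
    using assms S by (simp add: psd_def del: Re_sum)
qed

lemma psd_sum: "(\<And>k. k < (N::nat) \<Longrightarrow> psd (P k)) \<Longrightarrow> psd (\<lambda>z w. \<Sum>k<N. P k z w)"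
  by (induction N) (simp_all add: psd_zero psd_add)

lemma psd_lim:
  fixes Q :: "complex ^ 'n \<Rightarrow> complex ^ 'n \<Rightarrow> complex"
  assumes P: "\<And>N::nat. psd (P N)"
    and lim: "\<And>z w. z \<in> unit_ball \<Longrightarrow> w \<in> unit_ball \<Longrightarrow> (\<lambda>N. P N z w) \<longlonglongrightarrow> Q z w"
  shows "psd Q"
  unfolding psd_def
proof (intro allI impI)
  fix S c assume S: "finite S" "S \<subseteq> (unit_ball :: (complex ^ 'n) set)"
  have "(\<lambda>N. Re (\<Sum>z\<in>S. \<Sum>w\<in>S. c z * cnj (c w) * P N z w))
      \<longlonglongrightarrow> Re (\<Sum>z\<in>S. \<Sum>w\<in>S. c z * cnj (c w) * Q z w)"
    using S by (intro tendsto_Re tendsto_sum tendsto_mult_left lim) auto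
  then show "0 \<le> Re (\<Sum>z\<in>S. \<Sum>w\<in>S. c z * cnj (c w) * Q z w)"
    using P S by (intro LIMSEQ_le_const) (auto simp: psd_def simp del: Re_sum)
qed

text \<open>A Gram kernel is a sum of rank-one kernels, and multiplying by a rank-one kernel only
  changes the coefficients \<open>c\<close>.\<close>

lemma psd_hdot_mult:
  fixes g :: "complex ^ 'n \<Rightarrow> complex ^ 'm"
  assumes "psd P"
  shows "psd (\<lambda>z w. hdot (g w) (g z) * P z w)"
  unfolding psd_def
proof (intro allI impI)
  fix S c assume S: "finite S" "S \<subseteq> (unit_ball :: (complex ^ 'n) set)"
  define d where "d l z = c z * cnj (g z $ l)" for l z
  have "(\<Sum>z\<in>S. \<Sum>w\<in>S. c z * cnj (c w) * (hdot (g w) (g z) * P z w)) =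
      (\<Sum>z\<in>S. \<Sum>w\<in>S. \<Sum>l\<in>UNIV. d l z * cnj (d l w) * P z w)"
    by (simp add: hdot_def d_def sum_distrib_left sum_distrib_right mult_ac)
  also have "\<dots> = (\<Sum>z\<in>S. \<Sum>l\<in>UNIV. \<Sum>w\<in>S. d l z * cnj (d l w) * P z w)"
    by (intro sum.cong refl sum.swap)
  also have "\<dots> = (\<Sum>l\<in>UNIV. \<Sum>z\<in>S. \<Sum>w\<in>S. d l z * cnj (d l w) * P z w)"
    by (rule sum.swap)
  finally show "0 \<le> Re (\<Sum>z\<in>S. \<Sum>w\<in>S. c z * cnj (c w) * (hdot (g w) (g z) * P z w))"
    using assms S by (simp only: Re_sum[where s = UNIV] psd_def sum_nonneg)
qed

text \<open>The quadratic form collapses to \<open>(norm v)\<^sup>2 - (norm (A v))\<^sup>2\<close>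
  for one vector \<open>v\<close>. Its coefficients are conjugated because \<open>hdot w z\<close>
  is antilinear in \<open>z\<close>.\<close>

lemma psd_hdot_diff_contraction:
  fixes A :: "complex ^ 'n \<Rightarrow> complex ^ 'n"
  assumes lin: "Vector_Spaces.linear (*s) (*s) A"
    and contr: "\<And>x. norm (A x) \<le> norm x"
  shows "psd (\<lambda>z w. hdot w z - hdot (A w) (A z))"
  unfolding psd_def
proof (intro allI impI)
  fix S c assume S: "finite S" "S \<subseteq> (unit_ball :: (complex ^ 'n) set)"
  define v where "v = (\<Sum>z\<in>S. cnj (c z) *s z)"
  have A0: "A 0 = 0"
    using lin clinear_iff[of A] by (metis vec.scale_zero_left)
  have Av: "A v = (\<Sum>z\<in>S. cnj (c z) *s A z)"
    unfolding v_def
    using S(1) lin by (induction S rule: finite_induct) (simp_all add: A0 clinear_iff)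
  have expand: "hdot (\<Sum>z\<in>S. cnj (c z) *s g z) (\<Sum>z\<in>S. cnj (c z) *s g z) =
      (\<Sum>z\<in>S. \<Sum>w\<in>S. c z * cnj (c w) * hdot (g w) (g z))" for g :: "complex ^ 'n \<Rightarrow> complex ^ 'n"
    by (simp add: hdot_sum_right hdot_sum_left hdot_scale_left hdot_scale_right sum_distrib_left mult_ac)
  have "(\<Sum>z\<in>S. \<Sum>w\<in>S. c z * cnj (c w) * (hdot w z - hdot (A w) (A z))) = hdot v v - hdot (A v) (A v)"
    unfolding Av expand[of A] unfolding v_def expand[of "\<lambda>z. z"]
    by (simp add: right_diff_distrib sum_subtractf)
  also have "\<dots> = complex_of_real ((norm v)\<^sup>2 - (norm (A v))\<^sup>2)"
    by (simp add: hdot_self)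
  finally show "0 \<le> Re (\<Sum>z\<in>S. \<Sum>w\<in>S. c z * cnj (c w) * (hdot w z - hdot (A w) (A z)))"
    using contr[of v] by (simp add: power_mono del: Re_sum)
qed

text \<open>Induction through \<open>x^(k+1) - y^(k+1) = x * (x^k - y^k) + y^k * (x - y)\<close>:
  both summands arise from positive semidefinite kernels by multiplying with Gram kernels.\<close>

lemma psd_hdot_power_diff:
  fixes A :: "complex ^ 'n \<Rightarrow> complex ^ 'n"
  assumes lin: "Vector_Spaces.linear (*s) (*s) A"
    and contr: "\<And>x. norm (A x) \<le> norm x"
  shows "psd (\<lambda>z w. hdot w z ^ k - hdot (A w) (A z) ^ k)"
proof (induction k)
  case 0
  then show ?case by (simp add: psd_zero)
next
  case (Suc k)
  have E: "psd (\<lambda>z w. hdot (A w) (A z) ^ j * (hdot w z - hdot (A w) (A z)))" for j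
  proof (induction j)
    case 0
    then show ?case using psd_hdot_diff_contraction[OF assms] by simp
  next
    case (Suc j)
    then show ?case
      using psd_hdot_mult[OF Suc, of A] by (simp add: mult.assoc)
  qed
  show ?case
    by (rule psd_cong[OF psd_add[OF psd_hdot_mult[OF Suc, of "\<lambda>z. z"] E[of k]]])
      (simp add: algebra_simps)
qed

text \<open>In the binomial series the sign of the coefficient cancels against that of
  \<open>(- x) ^ k\<close>. What remains is positive for positive \<open>\<gamma>\<close>, so the
  series preserves positive semidefiniteness term by term.\<close>

lemma one_minus_powr_sums:
  fixes x :: complex
  assumes "cmod x < 1"
  shows "(\<lambda>k. complex_of_real (pochhammer \<gamma> k / fact k) * x ^ k)
     sums ((1 - x) powr (- complex_of_real \<gamma>))"
proof -
  have "(\<lambda>k. (- complex_of_real \<gamma> gchoose k) * (- x) ^ k) sums ((1 + - x) powr (- complex_of_real \<gamma>))"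
    using assms by (intro gen_binomial_complex) simp
  moreover have "(- complex_of_real \<gamma> gchoose k) * (- x) ^ k =
      complex_of_real (pochhammer \<gamma> k / fact k) * x ^ k" for k
  proof -
    have "(- 1) ^ k * (- x) ^ k = x ^ k"
      by (simp flip: power_mult_distrib)
    then show ?thesis
      by (simp add: gbinomial_pochhammer pochhammer_of_real mult_ac)
  qed
  ultimately show ?thesis by simp
qed

lemma kern_eq:
  "w \<in> unit_ball \<Longrightarrow> kern \<gamma> z w = (1 - hdot w z) powr (- complex_of_real \<gamma>)"
  by (simp add: kern_def on_ball_def)

lemma psd_kern_diff_contraction:
  fixes A :: "complex ^ 'n \<Rightarrow> complex ^ 'n"
  assumes \<gamma>: "0 < \<gamma>" and lin: "Vector_Spaces.linear (*s) (*s) A"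
    and contr: "\<And>x. norm (A x) \<le> norm x"
  shows "psd (\<lambda>z w. kern \<gamma> z w - kern \<gamma> (A z) (A w))"
proof (rule psd_lim)
  show "psd (\<lambda>z w. \<Sum>k<N. complex_of_real (pochhammer \<gamma> k / fact k) *
      (hdot w z ^ k - hdot (A w) (A z) ^ k))" for N
    using \<gamma> by (intro psd_sum psd_scale psd_hdot_power_diff assms)
      (simp_all add: pochhammer_pos less_imp_le)
next
  fix z w :: "complex ^ 'n" assume zw: "z \<in> unit_ball" "w \<in> unit_ball"
  have A: "A x \<in> unit_ball" if "x \<in> unit_ball" for x
    using contr[of x] that by simp
  have "(\<lambda>k. complex_of_real (pochhammer \<gamma> k / fact k) * hdot w z ^ k -
      complex_of_real (pochhammer \<gamma> k / fact k) * hdot (A w) (A z) ^ k)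
      sums (kern \<gamma> z w - kern \<gamma> (A z) (A w))"
    unfolding kern_eq[OF zw(2)] kern_eq[OF A[OF zw(2)]]
    using zw A by (intro sums_diff one_minus_powr_sums norm_hdot_less_1)
  then show "(\<lambda>N. \<Sum>k<N. complex_of_real (pochhammer \<gamma> k / fact k) *
      (hdot w z ^ k - hdot (A w) (A z) ^ k)) \<longlonglongrightarrow> kern \<gamma> z w - kern \<gamma> (A z) (A w)"
    by (simp add: sums_def right_diff_distrib)
qed

section \<open>Weighted composition operators\<close>

lemma wcomp_add: "wcomp f \<phi> (\<lambda>x. g x + h x) = (\<lambda>x. wcomp f \<phi> g x + wcomp f \<phi> h x)"
  by (auto simp: wcomp_def on_ball_def distrib_left)

lemma wcomp_scale: "wcomp f \<phi> (\<lambda>x. c * h x) = (\<lambda>x. c * wcomp f \<phi> h x)"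
  by (auto simp: wcomp_def on_ball_def)

lemma wcomp_sum:
  "finite S \<Longrightarrow> wcomp f \<phi> (\<lambda>x. \<Sum>i\<in>S. g i x) = (\<lambda>x. \<Sum>i\<in>S. wcomp f \<phi> (g i) x)"
  by (auto simp: wcomp_def on_ball_def sum_distrib_left)

section \<open>Finite combinations of kernels and the contraction criterion\<close>

definition kern_span :: "real \<Rightarrow> (complex ^ 'n \<Rightarrow> complex) set" where
  "kern_span \<gamma> = {u. \<exists>S c. finite S \<and> S \<subseteq> unit_ball \<and> u = (\<lambda>w. \<Sum>z\<in>S. c z * kern \<gamma> z w)}"

lemma kern_spanI:
  "finite S \<Longrightarrow> S \<subseteq> unit_ball \<Longrightarrow> (\<lambda>w. \<Sum>z\<in>S. c z * kern \<gamma> z w) \<in> kern_span \<gamma>"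
  unfolding kern_span_def by blast

lemma kern_in_span: "z \<in> unit_ball \<Longrightarrow> kern \<gamma> z \<in> kern_span \<gamma>"
  using kern_spanI[of "{z}" "\<lambda>_. 1" \<gamma>] by simp

lemma kern_span_zero: "(\<lambda>_. 0) \<in> kern_span \<gamma>"
  using kern_spanI[of "{}" "\<lambda>_. 1" \<gamma>] by simp

lemma kern_span_scale:
  assumes "u \<in> kern_span \<gamma>"
  shows "(\<lambda>x. a * u x) \<in> kern_span \<gamma>"
proof -
  obtain S c where "finite S" "S \<subseteq> unit_ball" "u = (\<lambda>w. \<Sum>z\<in>S. c z * kern \<gamma> z w)"
    using assms by (auto simp: kern_span_def)
  then show ?thesis
    using kern_spanI[of S "\<lambda>z. a * c z" \<gamma>] by (simp add: sum_distrib_left mult.assoc)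
qed

lemma kern_span_add:
  assumes "u \<in> kern_span \<gamma>" "v \<in> kern_span \<gamma>"
  shows "(\<lambda>x. u x + v x) \<in> kern_span \<gamma>"
proof -
  obtain S c where S: "finite S" "S \<subseteq> unit_ball" "u = (\<lambda>w. \<Sum>z\<in>S. c z * kern \<gamma> z w)"
    using assms(1) by (auto simp: kern_span_def)
  obtain R d where R: "finite R" "R \<subseteq> unit_ball" "v = (\<lambda>w. \<Sum>z\<in>R. d z * kern \<gamma> z w)"
    using assms(2) by (auto simp: kern_span_def)
  \<comment> \<open>The two point sets may overlap, so both coefficient families are extended by
    zero to the union before they are added.\<close>
  define e where "e z = (if z \<in> S then c z else 0) + (if z \<in> R then d z else 0)" for z
  have "(\<lambda>x. u x + v x) = (\<lambda>w. \<Sum>z\<in>S \<union> R. e z * kern \<gamma> z w)"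
  proof
    fix w
    have "u w = (\<Sum>z\<in>S \<union> R. (if z \<in> S then c z else 0) * kern \<gamma> z w)"
      unfolding S(3) using S(1) R(1) by (intro sum.mono_neutral_cong_left) auto
    moreover have "v w = (\<Sum>z\<in>S \<union> R. (if z \<in> R then d z else 0) * kern \<gamma> z w)"
      unfolding R(3) using S(1) R(1) by (intro sum.mono_neutral_cong_left) auto
    ultimately show "u w + v w = (\<Sum>z\<in>S \<union> R. e z * kern \<gamma> z w)"
      by (simp add: e_def distrib_right sum.distrib)
  qed
  then show ?thesis
    using S R kern_spanI[of "S \<union> R" e \<gamma>] by simp
qed

lemma (in hilbert_function_space) hnorm_sum_sq:
  assumes S: "finite S" and g: "\<And>i. i \<in> S \<Longrightarrow> g i \<in> H"
  shows "(hnorm ip (\<lambda>x. \<Sum>i\<in>S. c i * g i x))\<^sup>2 =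
    Re (\<Sum>i\<in>S. \<Sum>j\<in>S. c i * cnj (c j) * ip (g i) (g j))"
  using assms
  by (simp add: hnorm_sq sum_mem scale_mem ip_sum ip_sum_right ip_scale ip_scale_right
      sum_distrib_left mult_ac del: Re_sum)

lemma (in hilbert_function_space) bounded_operatorI:
  assumes "\<And>h. h \<in> H \<Longrightarrow> T h \<in> H"
    and "\<And>g h. T (\<lambda>x. g x + h x) = (\<lambda>x. T g x + T h x)"
    and "\<And>c h. T (\<lambda>x. c * h x) = (\<lambda>x. c * T h x)"
    and "\<And>h. h \<in> H \<Longrightarrow> hnorm ip (T h) \<le> C * hnorm ip h"
  shows "bounded_operator H ip T"
  using assms unfolding bounded_operator_def by blast

context kernel_space
begin

lemma kern_span_subset: "kern_span \<gamma> \<subseteq> H"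
  by (auto simp: kern_span_def intro!: sum_mem scale_mem kern_mem)

lemma ip_kern_left:
  assumes "h \<in> H" "z \<in> unit_ball"
  shows "ip (kern \<gamma> z) h = cnj (h z)"
  using assms ip_commute[of "kern \<gamma> z" h] reproducing[of h z] kern_mem by simp

lemma ip_kern_kern: "z \<in> unit_ball \<Longrightarrow> w \<in> unit_ball \<Longrightarrow> ip (kern \<gamma> z) (kern \<gamma> w) = kern \<gamma> z w"
  using reproducing[of "kern \<gamma> z" w] kern_mem by simp

text \<open>If \<open>T\<close> acts on kernels as the adjoint of \<open>wcomp f \<phi>\<close> should act, then the vector
  representing \<open>u \<mapsto> ip (T u) h\<close> is \<open>wcomp f \<phi> h\<close>.\<close>

lemma wcomp_of_predual:
  assumes self: "\<And>z. z \<in> unit_ball \<Longrightarrow> \<phi> z \<in> unit_ball"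
    and Tadd: "\<And>g h. T (\<lambda>x. g x + h x) = (\<lambda>x. T g x + T h x)"
    and Tscale: "\<And>c h. T (\<lambda>x. c * h x) = (\<lambda>x. c * T h x)"
    and Tkern: "\<And>z. z \<in> unit_ball \<Longrightarrow> T (kern \<gamma> z) = (\<lambda>w. cnj (f z) * kern \<gamma> (\<phi> z) w)"
    and D: "D \<subseteq> H" "kern_span \<gamma> \<subseteq> D"
    and Dadd: "\<And>u v. u \<in> D \<Longrightarrow> v \<in> D \<Longrightarrow> (\<lambda>x. u x + v x) \<in> D"
    and Dscale: "\<And>c u. u \<in> D \<Longrightarrow> (\<lambda>x. c * u x) \<in> D"
    and TH: "\<And>u. u \<in> D \<Longrightarrow> T u \<in> H"
    and Tnorm: "\<And>u. u \<in> D \<Longrightarrow> hnorm ip (T u) \<le> hnorm ip u"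
    and h: "h \<in> H"
  shows "wcomp f \<phi> h \<in> H" "hnorm ip (wcomp f \<phi> h) \<le> hnorm ip h"
    "\<And>u. u \<in> D \<Longrightarrow> ip (T u) h = ip u (wcomp f \<phi> h)"
proof -
  \<comment> \<open>Since \<open>T\<close> is a contraction on \<open>D\<close>, Cauchy-Schwarz
    bounds the functional by \<open>hnorm ip h\<close>. This constant becomes the norm estimate for
    \<open>wcomp f \<phi> h\<close>.\<close>
  have "\<exists>g\<in>H. hnorm ip g \<le> hnorm ip h \<and> (\<forall>u\<in>D. ip (T u) h = ip u g)"
  proof (rule riesz)
    show "(\<lambda>_. 0) \<in> D" using D kern_span_zero by blast
    show "cmod (ip (T u) h) \<le> hnorm ip h * hnorm ip u" if "u \<in> D" for u
      using cauchy_schwarz[OF TH[OF that] h] Tnorm[OF that] hnorm_nonneg[OF h]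
      by (metis mult.commute mult_left_mono order_trans)
  qed (use D Dadd Dscale TH h in \<open>simp_all add: Tadd Tscale ip_add ip_scale hnorm_nonneg\<close>)
  then obtain g where g: "g \<in> H" "hnorm ip g \<le> hnorm ip h"
      and repr: "\<And>u. u \<in> D \<Longrightarrow> ip (T u) h = ip u g"
    by blast
  have "g = wcomp f \<phi> h"
  proof
    fix z
    show "g z = wcomp f \<phi> h z"
    proof (cases "z \<in> unit_ball")
      case True
      then have "kern \<gamma> z \<in> D" using D kern_in_span by blast
      then have "cnj (g z) = ip (T (kern \<gamma> z)) h"
        using repr ip_kern_left[OF g(1) True] by simp
      also have "\<dots> = cnj (f z * h (\<phi> z))"
        using True self[OF True] h by (simp add: Tkern ip_scale kern_mem ip_kern_left)
      finally have "g z = f z * h (\<phi> z)"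
        by (simp only: complex_cnj_cancel_iff)
      then show ?thesis using True by (simp add: wcomp_def on_ball_def)
    next
      case False
      then show ?thesis using g zero_off_ball by (simp add: wcomp_def on_ball_def)
    qed
  qed
  with g repr show "wcomp f \<phi> h \<in> H" "hnorm ip (wcomp f \<phi> h) \<le> hnorm ip h"
    "\<And>u. u \<in> D \<Longrightarrow> ip (T u) h = ip u (wcomp f \<phi> h)"
    by simp_all
qed

text \<open>The candidate adjoint is itself a weighted composition \<open>wcomp g \<psi>\<close>,
  hence defined and linear on all functions. Its value on a combination of kernels thus does not
  depend on how the combination is written. The hypothesis on the kernel difference says that it
  does not increase norms on \<open>kern_span \<gamma>\<close>, and duality transfers this to
  \<open>wcomp f \<phi>\<close>.\<close>

lemma wcomp_contraction:
  assumes self: "\<And>z. z \<in> unit_ball \<Longrightarrow> \<phi> z \<in> unit_ball"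
    and kern: "\<And>z. z \<in> unit_ball \<Longrightarrow> wcomp g \<psi> (kern \<gamma> z) = (\<lambda>w. cnj (f z) * kern \<gamma> (\<phi> z) w)"
    and psd: "psd (\<lambda>z w. kern \<gamma> z w - cnj (f z) * f w * kern \<gamma> (\<phi> z) (\<phi> w))"
    and h: "h \<in> H"
  shows "wcomp f \<phi> h \<in> H" "hnorm ip (wcomp f \<phi> h) \<le> hnorm ip h"
proof -
  have T: "wcomp g \<psi> u \<in> H \<and> hnorm ip (wcomp g \<psi> u) \<le> hnorm ip u" if u: "u \<in> kern_span \<gamma>" for u
  proof -
    obtain S c where S: "finite S" "S \<subseteq> unit_ball" and u_eq: "u = (\<lambda>w. \<Sum>z\<in>S. c z * kern \<gamma> z w)"
      using u by (auto simp: kern_span_def)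
    have mem: "kern \<gamma> z \<in> H" "kern \<gamma> (\<phi> z) \<in> H" if "z \<in> S" for z
      using S(2) that self by (auto intro!: kern_mem)
    have Tu: "wcomp g \<psi> u = (\<lambda>w. \<Sum>z\<in>S. (c z * cnj (f z)) * kern \<gamma> (\<phi> z) w)"
      unfolding u_eq using S
      by (simp add: wcomp_sum wcomp_scale kern subset_eq mult.assoc)
    have "(hnorm ip (wcomp g \<psi> u))\<^sup>2 = Re (\<Sum>z\<in>S. \<Sum>w\<in>S. (c z * cnj (f z)) * cnj (c w * cnj (f w)) *
        ip (kern \<gamma> (\<phi> z)) (kern \<gamma> (\<phi> w)))"
      unfolding Tu using S mem by (intro hnorm_sum_sq) auto
    also have "(\<Sum>z\<in>S. \<Sum>w\<in>S. (c z * cnj (f z)) * cnj (c w * cnj (f w)) *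
        ip (kern \<gamma> (\<phi> z)) (kern \<gamma> (\<phi> w))) =
        (\<Sum>z\<in>S. \<Sum>w\<in>S. c z * cnj (c w) * (cnj (f z) * f w * kern \<gamma> (\<phi> z) (\<phi> w)))"
    proof (intro sum.cong refl)
      fix z w assume "z \<in> S" "w \<in> S"
      then show "(c z * cnj (f z)) * cnj (c w * cnj (f w)) * ip (kern \<gamma> (\<phi> z)) (kern \<gamma> (\<phi> w)) =
          c z * cnj (c w) * (cnj (f z) * f w * kern \<gamma> (\<phi> z) (\<phi> w))"
        using S(2) self by (simp add: ip_kern_kern subset_eq mult_ac)
    qed
    finally have nT: "(hnorm ip (wcomp g \<psi> u))\<^sup>2 =
        Re (\<Sum>z\<in>S. \<Sum>w\<in>S. c z * cnj (c w) * (cnj (f z) * f w * kern \<gamma> (\<phi> z) (\<phi> w)))" .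
    have "(hnorm ip u)\<^sup>2 = Re (\<Sum>z\<in>S. \<Sum>w\<in>S. c z * cnj (c w) * ip (kern \<gamma> z) (kern \<gamma> w))"
      unfolding u_eq using S mem by (intro hnorm_sum_sq) auto
    also have "(\<Sum>z\<in>S. \<Sum>w\<in>S. c z * cnj (c w) * ip (kern \<gamma> z) (kern \<gamma> w)) =
        (\<Sum>z\<in>S. \<Sum>w\<in>S. c z * cnj (c w) * kern \<gamma> z w)"
      using S(2) by (intro sum.cong refl) (simp add: ip_kern_kern subset_eq)
    finally have nu: "(hnorm ip u)\<^sup>2 = Re (\<Sum>z\<in>S. \<Sum>w\<in>S. c z * cnj (c w) * kern \<gamma> z w)" .
    have "0 \<le> Re (\<Sum>z\<in>S. \<Sum>w\<in>S. c z * cnj (c w) *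
        (kern \<gamma> z w - cnj (f z) * f w * kern \<gamma> (\<phi> z) (\<phi> w)))"
      using psd S by (simp add: psd_def del: Re_sum)
    then have "(hnorm ip (wcomp g \<psi> u))\<^sup>2 \<le> (hnorm ip u)\<^sup>2"
      unfolding nT nu by (simp add: right_diff_distrib sum_subtractf del: Re_sum)
    moreover have "u \<in> H" using u kern_span_subset by blast
    moreover have "wcomp g \<psi> u \<in> H"
      unfolding Tu using S mem by (intro sum_mem scale_mem)
    ultimately show ?thesis
      using hnorm_nonneg power2_le_imp_le by blast
  qed
  note predual = wcomp_of_predual[of \<phi> "wcomp g \<psi>" f "kern_span \<gamma>", OF self wcomp_add wcomp_scale
      kern kern_span_subset order_refl kern_span_add kern_span_scale]
  show "wcomp f \<phi> h \<in> H" "hnorm ip (wcomp f \<phi> h) \<le> hnorm ip h"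
    using predual T h by blast+
qed

text \<open>The duality argument is repeated with \<open>D = H\<close>: once
  \<open>wcomp g \<psi>\<close> is a contraction of the whole space, the adjoint relation holds
  beyond the span of the kernels.\<close>

lemma wcomp_adjoint:
  assumes self: "\<And>z. z \<in> unit_ball \<Longrightarrow> \<phi> z \<in> unit_ball"
    and kern: "\<And>z. z \<in> unit_ball \<Longrightarrow> wcomp g \<psi> (kern \<gamma> z) = (\<lambda>w. cnj (f z) * kern \<gamma> (\<phi> z) w)"
    and mem: "\<And>h. h \<in> H \<Longrightarrow> wcomp g \<psi> h \<in> H"
    and contr: "\<And>h. h \<in> H \<Longrightarrow> hnorm ip (wcomp g \<psi> h) \<le> hnorm ip h"
    and h: "h \<in> H" and u: "u \<in> H"
  shows "ip (wcomp g \<psi> u) h = ip u (wcomp f \<phi> h)"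
  by (rule wcomp_of_predual(3)[of \<phi> "wcomp g \<psi>" f H, OF self wcomp_add wcomp_scale
      kern order_refl kern_span_subset add_mem scale_mem mem contr h u])

end

section \<open>Moebius involutions\<close>

text \<open>Both arguments lie strictly between \<open>- pi / 2\<close> and \<open>pi / 2\<close>,
  so their sum stays within the principal range and the logarithms add. It applies to the factors
  \<open>1 - hdot z w\<close>, whose real part is positive on the ball.\<close>

lemma powr_mult_Re_pos:
  fixes x y :: complex
  assumes "0 < Re x" "0 < Re y"
  shows "(x * y) powr s = x powr s * y powr s"
proof -
  have nz: "x \<noteq> 0" "y \<noteq> 0" using assms by auto
  have "\<bar>Im (Ln x)\<bar> < pi / 2" "\<bar>Im (Ln y)\<bar> < pi / 2"
    using assms by (auto intro: Re_Ln_pos_lt_imp simp del: less_divide_eq_numeral1)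
  then have "Ln (x * y) = Ln x + Ln y"
    using nz by (intro Ln_times_simple) auto
  then show ?thesis
    using nz by (simp add: powr_def distrib_left exp_add)
qed

lemma unit_ball_norm_sq_pos: "a \<in> unit_ball \<Longrightarrow> 0 < 1 - (norm a)\<^sup>2"
  by (simp add: power_less_one_iff abs_square_less_1)

text \<open>Since \<open>norm a ^ 2 = (1 - s) * (1 + s)\<close>, the projection onto \<open>a\<close> can be written without
  dividing by \<open>norm a\<close>, which also covers \<open>a = 0\<close>.\<close>

lemma moebius_eq:
  assumes a: "a \<in> unit_ball"
  defines "s \<equiv> complex_of_real (sqrt (1 - (norm a)\<^sup>2))"
  shows "moebius a z =
    (1 / (1 - hdot z a)) *s ((1 - hdot z a / (1 + s)) *s a - s *s z)"
proof (cases "a = 0")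
  case True
  then have "hdot z a = 0" "s = 1" by (simp_all add: s_def)
  with True show ?thesis by (simp add: moebius_def)
next
  case False
  define r where "r = sqrt (1 - (norm a)\<^sup>2)"
  have r: "0 \<le> r" "r\<^sup>2 = 1 - (norm a)\<^sup>2"
    using unit_ball_norm_sq_pos[OF a] by (simp_all add: r_def)
  have s: "s = complex_of_real r" by (simp add: s_def r_def)
  have "(norm a)\<^sup>2 = (1 - r) * (1 + r)"
    using r(2) by (simp add: algebra_simps power2_eq_square)
  then have N: "complex_of_real ((norm a)\<^sup>2) = (1 - s) * (1 + s)"
    by (simp add: s del: of_real_power)
  moreover have "complex_of_real ((norm a)\<^sup>2) \<noteq> 0"
    using False by simp
  ultimately have "1 - s \<noteq> 0" by auto
  then have k: "t / complex_of_real ((norm a)\<^sup>2) * (1 - s) = t / (1 + s)" for t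
    unfolding N by (simp add: divide_divide_eq_left')
  define q where "q = hdot z a / complex_of_real ((norm a)\<^sup>2)"
  have "moebius a z = (1 / (1 - hdot z a)) *s (a - q *s a - s *s (z - q *s a))"
    using False by (simp only: moebius_def if_False proj_def scaleR_eq_scale q_def s_def)
  also have "a - q *s a - s *s (z - q *s a) = (1 - q * (1 - s)) *s a - s *s z"
    by (simp add: vec_eq_iff algebra_simps)
  finally show ?thesis by (simp only: q_def k)
qed

lemma hdot_moebius_left:
  assumes "a \<in> unit_ball"
  defines "s \<equiv> complex_of_real (sqrt (1 - (norm a)\<^sup>2))"
  shows "hdot (moebius a w) z =
    ((1 - hdot w a / (1 + s)) * hdot a z - s * hdot w z) / (1 - hdot w a)"
  unfolding moebius_eq[OF assms(1)] s_def
  by (simp only: hdot_scale_left hdot_diff_left) simp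

lemma one_minus_divide_mult: "u \<noteq> 0 \<Longrightarrow> (1 - x / u) * u = u - x" for x u :: "'a :: field"
  by (simp add: left_diff_distrib)

text \<open>After the denominators are cleared, both sides equal \<open>1 - hdot w a - hdot a z +
  hdot w a * hdot a z / (1 + s) + s * hdot w z\<close>. Raised to the power
  \<open>- \<gamma>\<close>, this identity describes the action of \<open>moebius_op\<close> on
  kernels.\<close>

lemma one_minus_hdot_moebius_swap:
  assumes a: "a \<in> unit_ball" and z: "z \<in> unit_ball" and w: "w \<in> unit_ball"
  shows "(1 - hdot (moebius a w) z) * (1 - hdot w a) = (1 - hdot w (moebius a z)) * (1 - hdot a z)"
proof -
  define s where "s = complex_of_real (sqrt (1 - (norm a)\<^sup>2))"
  have "hdot w (moebius a z) = cnj (hdot (moebius a z) w)"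
    by (simp add: cnj_hdot)
  then have 1: "hdot w (moebius a z) =
      ((1 - hdot a z / (1 + s)) * hdot w a - s * hdot w z) / (1 - hdot a z)"
    by (simp add: hdot_moebius_left[OF a] cnj_hdot s_def)
  have "1 - hdot w a \<noteq> 0" "1 - hdot a z \<noteq> 0"
    using Re_one_minus_hdot_pos[OF w a] Re_one_minus_hdot_pos[OF a z] by (auto simp: complex_eq_iff)
  then show ?thesis
    unfolding 1 hdot_moebius_left[OF a] s_def[symmetric]
    by (simp only: one_minus_divide_mult not_False_eq_True) (simp add: algebra_simps)
qed

lemma one_plus_sqrt_nonzero:
  "a \<in> unit_ball \<Longrightarrow> 1 + complex_of_real (sqrt (1 - (norm a)\<^sup>2)) \<noteq> 0"
  using unit_ball_norm_sq_pos[of a] by (simp add: complex_eq_iff add_nonneg_eq_0_iff)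

lemma sqrt_one_minus_norm_sq_sq: "a \<in> unit_ball \<Longrightarrow>
  (complex_of_real (sqrt (1 - (norm a)\<^sup>2)))\<^sup>2 = 1 - hdot a a"
  using unit_ball_norm_sq_pos[of a] by (simp add: hdot_self flip: of_real_power)

text \<open>As \<open>a = moebius a 0\<close>, this is the classical formula for
  \<open>1 - hdot (moebius a z) (moebius a w)\<close> at \<open>w = 0\<close>.\<close>

lemma one_minus_hdot_moebius_self:
  assumes a: "a \<in> unit_ball" and z: "z \<in> unit_ball"
  shows "(1 - hdot (moebius a z) a) * (1 - hdot z a) = 1 - hdot a a"
proof -
  define s where "s = complex_of_real (sqrt (1 - (norm a)\<^sup>2))"
  have s: "1 + s \<noteq> 0" "hdot a a = 1 - s\<^sup>2"
    using one_plus_sqrt_nonzero[OF a] sqrt_one_minus_norm_sq_sq[OF a] by (simp_all add: s_def)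
  have "1 - hdot z a \<noteq> 0"
    using Re_one_minus_hdot_pos[OF z a] by (auto simp: complex_eq_iff)
  then have "(1 - hdot (moebius a z) a) * (1 - hdot z a) =
      1 - hdot z a - ((1 - hdot z a / (1 + s)) * ((1 - s) * (1 + s)) - s * hdot z a)"
    unfolding hdot_moebius_left[OF a] s_def[symmetric]
    by (simp only: one_minus_divide_mult not_False_eq_True) (simp add: s(2) algebra_simps power2_eq_square)
  also have "(1 - hdot z a / (1 + s)) * ((1 - s) * (1 + s)) = (1 - s) * (1 + s - hdot z a)"
    using s(1) by (simp add: one_minus_divide_mult mult.left_commute)
  also have "1 - hdot z a - ((1 - s) * (1 + s - hdot z a) - s * hdot z a) = s\<^sup>2"
    by (simp add: algebra_simps power2_eq_square)
  finally show ?thesis using s(2) by simp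
qed

lemma moebius_moebius:
  assumes a: "a \<in> unit_ball" and z: "z \<in> unit_ball"
  shows "moebius a (moebius a z) = z"
proof -
  define s where "s = complex_of_real (sqrt (1 - (norm a)\<^sup>2))"
  define t where "t = hdot z a"
  define t' where "t' = hdot (moebius a z) a"
  have s: "1 + s \<noteq> 0" "hdot a a = 1 - s\<^sup>2" "s \<noteq> 0"
    using one_plus_sqrt_nonzero[OF a] sqrt_one_minus_norm_sq_sq[OF a] unit_ball_norm_sq_pos[OF a] by (auto simp: s_def)
  have t: "1 - t \<noteq> 0"
    using Re_one_minus_hdot_pos[OF z a] by (auto simp: complex_eq_iff t_def)
  have "(1 - t') * (1 - t) = s\<^sup>2"
    using one_minus_hdot_moebius_self[OF a z] s(2) by (simp add: t_def t'_def)
  then have t': "1 - t' = s\<^sup>2 / (1 - t)" "t' = 1 - s\<^sup>2 / (1 - t)"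
    using t by (simp_all add: field_simps)
  \<comment> \<open>The outer coefficient of \<open>a\<close> matches \<open>s\<close> times the one
    inside \<open>moebius a z\<close>, so the multiples of \<open>a\<close> cancel and only a
    multiple of \<open>z\<close> survives.\<close>
  have coeff: "(1 - t' / (1 + s)) = s * (1 - t / (1 + s)) / (1 - t)"
    unfolding t'(2) using t s(1) by (simp add: divide_simps) (simp add: algebra_simps power2_eq_square)
  have "moebius a (moebius a z) = (1 / (1 - t')) *s ((1 - t' / (1 + s)) *s a -
      s *s ((1 / (1 - t)) *s ((1 - t / (1 + s)) *s a - s *s z)))"
    unfolding moebius_eq[OF a, of "moebius a z"]
    unfolding moebius_eq[OF a, of z] t_def t'_def s_def ..
  also have "\<dots> = ((1 - t) / s\<^sup>2) *s ((s * s / (1 - t)) *s z)"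
    unfolding coeff t'(1) using t s(3) by (simp add: vec_eq_iff algebra_simps diff_divide_distrib)
  also have "\<dots> = z"
    using t s(3) by (simp add: vec_eq_iff power2_eq_square)
  finally show ?thesis .
qed

text \<open>It follows from the classical identity \<open>(1 - (norm (moebius a z))\<^sup>2) * (cmod
  (1 - hdot z a))\<^sup>2 = (1 - (norm a)\<^sup>2) * (1 - (norm z)\<^sup>2)\<close>, whose
  right-hand side is positive.\<close>

lemma moebius_in_ball:
  assumes a: "a \<in> unit_ball" and z: "z \<in> unit_ball"
  shows "moebius a z \<in> unit_ball"
proof -
  define s where "s = complex_of_real (sqrt (1 - (norm a)\<^sup>2))"
  define t where "t = hdot z a"
  have s: "1 + s \<noteq> 0" "hdot a a = 1 - s\<^sup>2" "cnj s = s"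
    using one_plus_sqrt_nonzero[OF a] sqrt_one_minus_norm_sq_sq[OF a] by (simp_all add: s_def)
  have t: "1 - t \<noteq> 0" "1 - cnj t \<noteq> 0"
    using Re_one_minus_hdot_pos[OF z a] by (auto simp: complex_eq_iff t_def)
  define k where "k = 1 / (1 + s)"
  have k: "k * (1 + s) = 1" "cnj k = k" using s(1,3) by (simp_all add: k_def)
  define x where "x = hdot z z"
  have "hdot (moebius a z) (moebius a z) * ((1 - t) * (1 - cnj t)) =
      hdot ((1 - k * t) *s a - s *s z) ((1 - k * t) *s a - s *s z)"
    unfolding moebius_eq[OF a, of z] k_def s_def[symmetric] t_def[symmetric]
    using t by (simp only: hdot_scale_left hdot_scale_right complex_cnj_divide complex_cnj_diff
        complex_cnj_one) (simp add: mult.commute)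
  also have "\<dots> = (1 - k * t) * (1 - k * cnj t) * (1 - s\<^sup>2) - (1 - k * t) * s * cnj t
      - s * (1 - k * cnj t) * t + s\<^sup>2 * x"
    by (simp only: hdot_scale_left hdot_scale_right hdot_diff_left hdot_diff_right s(2))
      (simp add: s(3) k(2) t_def x_def cnj_hdot algebra_simps power2_eq_square)
  also have "\<dots> = (1 - t) * (1 - cnj t) - s\<^sup>2 * (1 - x)"
  proof -
    \<comment> \<open>Here \<open>k\<close> is treated as an indeterminate: the difference of the
      two sides is a polynomial multiple of \<open>k * (1 + s) - 1\<close>, which is zero.\<close>
    have "(1 - k * t) * (1 - k * cnj t) * (1 - s\<^sup>2) - (1 - k * t) * s * cnj t
        - s * (1 - k * cnj t) * t + s\<^sup>2 * x - ((1 - t) * (1 - cnj t) - s\<^sup>2 * (1 - x)) =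
        (k * (1 + s) - 1) * ((k * (1 - s) + 1) * (t * cnj t) - (1 - s) * (t + cnj t))"
      by (simp add: algebra_simps power2_eq_square)
    then show ?thesis
      by (simp only: k(1) diff_self mult_zero_left right_minus_eq)
  qed
  finally have eq: "hdot (moebius a z) (moebius a z) * ((1 - t) * (1 - cnj t)) =
      (1 - t) * (1 - cnj t) - s\<^sup>2 * (1 - x)" .
  have E1: "(1 - hdot (moebius a z) (moebius a z)) * ((1 - t) * (1 - cnj t)) = s\<^sup>2 * (1 - x)"
    unfolding left_diff_distrib[of 1 "hdot (moebius a z) (moebius a z)"] eq by simp
  have E2: "(1 - t) * (1 - cnj t) = complex_of_real ((cmod (1 - t))\<^sup>2)"
    using complex_norm_square[of "1 - t"] by simp
  have E3: "s\<^sup>2 = complex_of_real (1 - (norm a)\<^sup>2)"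
    using s(2) by (simp add: hdot_self)
  have "complex_of_real ((1 - (norm (moebius a z))\<^sup>2) * (cmod (1 - t))\<^sup>2) =
      (1 - hdot (moebius a z) (moebius a z)) * ((1 - t) * (1 - cnj t))"
    unfolding E2 hdot_self by simp
  also have "\<dots> = complex_of_real ((1 - (norm a)\<^sup>2) * (1 - (norm z)\<^sup>2))"
    by (subst E1) (simp add: E3 x_def hdot_self)
  finally have "(1 - (norm (moebius a z))\<^sup>2) * (cmod (1 - t))\<^sup>2 = (1 - (norm a)\<^sup>2) * (1 - (norm z)\<^sup>2)"
    by (simp only: of_real_eq_iff)
  also have "\<dots> > 0"
    using a z by (intro mult_pos_pos unit_ball_norm_sq_pos)
  finally have "0 < 1 - (norm (moebius a z))\<^sup>2"
    by (rule zero_less_mult_pos2) (use t(1) in simp)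
  then show ?thesis
    by (simp add: power_less_one_iff abs_square_less_1)
qed

lemma moebius_zero: "a \<in> unit_ball \<Longrightarrow> moebius a 0 = a"
  by (simp add: moebius_eq)

lemma moebius_self: "a \<in> unit_ball \<Longrightarrow> moebius a a = 0"
  using moebius_moebius[of a 0] by (simp add: moebius_zero)

section \<open>Normalized kernels and the unitary operator of the involution\<close>

lemma nkern_eq_powr:
  "z \<in> unit_ball \<Longrightarrow> nkern \<gamma> a z = complex_of_real ((1 - (norm a)\<^sup>2) powr (\<gamma> / 2)) *
    (1 - hdot z a) powr (- complex_of_real \<gamma>)"
  by (simp add: nkern_def on_ball_def)

lemma nkern_eq_kern:
  "nkern \<gamma> a z = complex_of_real ((1 - (norm a)\<^sup>2) powr (\<gamma> / 2)) * kern \<gamma> a z"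
  by (simp add: nkern_def kern_def on_ball_def)

lemma nkern_nonzero:
  assumes "a \<in> unit_ball" "z \<in> unit_ball"
  shows "nkern \<gamma> a z \<noteq> 0"
  using unit_ball_norm_sq_pos[OF assms(1)] Re_one_minus_hdot_pos[OF assms(2,1)] assms(2)
  by (auto simp: nkern_eq_powr)

lemma cnj_one_minus_hdot_powr:
  assumes "z \<in> unit_ball" "w \<in> unit_ball"
  shows "cnj ((1 - hdot z w) powr (- complex_of_real \<gamma>)) = (1 - hdot w z) powr (- complex_of_real \<gamma>)"
  using Re_one_minus_hdot_pos[OF assms] by (subst cnj_powr) (auto simp: cnj_hdot)

text \<open>The two normalizing factors contribute the power \<open>\<gamma>\<close> of
  \<open>1 - (norm a)\<^sup>2\<close>, the two kernels the power \<open>- \<gamma>\<close>. This is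
  the weight that arises when \<open>moebius_op\<close> is applied twice.\<close>

lemma nkern_mult_moebius:
  assumes a: "a \<in> unit_ball" and z: "z \<in> unit_ball"
  shows "nkern \<gamma> a z * nkern \<gamma> a (moebius a z) = 1"
proof -
  define c where "c = 1 - (norm a)\<^sup>2"
  have c: "0 < c" using unit_ball_norm_sq_pos[OF a] by (simp add: c_def)
  have m: "moebius a z \<in> unit_ball" using a z by (rule moebius_in_ball)
  have "(1 - hdot (moebius a z) a) powr (- complex_of_real \<gamma>) * (1 - hdot z a) powr (- complex_of_real \<gamma>)
      = complex_of_real c powr complex_of_real (- \<gamma>)"
    using powr_mult_Re_pos[OF Re_one_minus_hdot_pos[OF m a] Re_one_minus_hdot_pos[OF z a],
        of "- complex_of_real \<gamma>"]
    by (simp add: one_minus_hdot_moebius_self[OF a z] c_def hdot_self)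
  also have "\<dots> = complex_of_real (c powr - \<gamma>)"
    using c by (simp only: powr_of_real less_imp_le)
  finally have "nkern \<gamma> a z * nkern \<gamma> a (moebius a z) =
      complex_of_real (c powr (\<gamma> / 2) * c powr (\<gamma> / 2) * c powr - \<gamma>)"
    using z m by (simp add: nkern_eq_powr c_def mult_ac)
  also have "c powr (\<gamma> / 2) * c powr (\<gamma> / 2) * c powr - \<gamma> = 1"
    using c by (simp flip: powr_add)
  finally show ?thesis by simp
qed

text \<open>The right-hand side is what the adjoint of \<open>moebius_op \<gamma> a\<close> has to
  do to a kernel. The operator can therefore serve as its own candidate adjoint in the contraction
  criterion.\<close>

lemma moebius_op_kern:
  assumes a: "a \<in> unit_ball" and z: "z \<in> unit_ball"
  shows "wcomp (nkern \<gamma> a) (moebius a) (kern \<gamma> z) =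
    (\<lambda>w. cnj (nkern \<gamma> a z) * kern \<gamma> (moebius a z) w)"
proof
  fix w
  show "wcomp (nkern \<gamma> a) (moebius a) (kern \<gamma> z) w =
      cnj (nkern \<gamma> a z) * kern \<gamma> (moebius a z) w"
  proof (cases "w \<in> unit_ball")
    case w: True
    note m = moebius_in_ball[OF a]
    have "(1 - hdot (moebius a w) z) powr (- complex_of_real \<gamma>) * (1 - hdot w a) powr (- complex_of_real \<gamma>)
       = (1 - hdot w (moebius a z)) powr (- complex_of_real \<gamma>) * (1 - hdot a z) powr (- complex_of_real \<gamma>)"
      using a z w m by (simp only: one_minus_hdot_moebius_swap Re_one_minus_hdot_pos flip: powr_mult_Re_pos)
    then show ?thesis
      using a z w m[OF w]
      by (simp add: wcomp_def on_ball_def nkern_eq_powr kern_eq cnj_one_minus_hdot_powr mult_ac)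
  qed (simp add: wcomp_def kern_def on_ball_def)
qed

text \<open>By this invariance the kernel to be tested for \<open>moebius_op\<close> in the
  contraction criterion vanishes on the ball. The proof evaluates the action on kernels at the point
  \<open>moebius a z\<close>.\<close>

lemma kern_moebius:
  assumes a: "a \<in> unit_ball" and z: "z \<in> unit_ball" and w: "w \<in> unit_ball"
  shows "cnj (nkern \<gamma> a z) * nkern \<gamma> a w * kern \<gamma> (moebius a z) (moebius a w) = kern \<gamma> z w"
proof -
  have "nkern \<gamma> a w * kern \<gamma> (moebius a z) (moebius a w) =
      cnj (nkern \<gamma> a (moebius a z)) * kern \<gamma> z w"
    using fun_cong[OF moebius_op_kern[OF a moebius_in_ball[OF a z], of \<gamma>], of w] w
    by (simp add: wcomp_def on_ball_def moebius_moebius[OF a z])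
  then have "cnj (nkern \<gamma> a z) * nkern \<gamma> a w * kern \<gamma> (moebius a z) (moebius a w) =
      cnj (nkern \<gamma> a z * nkern \<gamma> a (moebius a z)) * kern \<gamma> z w"
    by (simp add: mult.assoc)
  then show ?thesis by (simp add: nkern_mult_moebius[OF a z])
qed

context kernel_space
begin

context
  fixes a :: "complex ^ 'n"
  assumes a: "a \<in> unit_ball"
begin

lemma moebius_op_contraction:
  assumes h: "h \<in> H"
  shows "moebius_op \<gamma> a h \<in> H" "hnorm ip (moebius_op \<gamma> a h) \<le> hnorm ip h"
proof -
  have psd: "psd (\<lambda>z w. kern \<gamma> z w -
      cnj (nkern \<gamma> a z) * nkern \<gamma> a w * kern \<gamma> (moebius a z) (moebius a w))"
    by (rule psd_cong[OF psd_zero]) (simp add: kern_moebius[OF a])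
  show "moebius_op \<gamma> a h \<in> H" "hnorm ip (moebius_op \<gamma> a h) \<le> hnorm ip h"
    unfolding moebius_op_def
    by (rule wcomp_contraction[OF moebius_in_ball[OF a] moebius_op_kern[OF a] psd h]; simp)+
qed

lemma moebius_op_adjoint:
  "g \<in> H \<Longrightarrow> h \<in> H \<Longrightarrow> ip (moebius_op \<gamma> a g) h = ip g (moebius_op \<gamma> a h)"
  unfolding moebius_op_def
  by (rule wcomp_adjoint[OF moebius_in_ball[OF a] moebius_op_kern[OF a]])
    (simp_all add: moebius_op_contraction flip: moebius_op_def)

lemma moebius_op_moebius_op:
  assumes "h \<in> H"
  shows "moebius_op \<gamma> a (moebius_op \<gamma> a h) = h"
proof
  fix z
  show "moebius_op \<gamma> a (moebius_op \<gamma> a h) z = h z"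
    using moebius_in_ball[OF a, of z] nkern_mult_moebius[OF a, of z \<gamma>] moebius_moebius[OF a, of z]
      zero_off_ball[OF assms, of z]
    by (simp add: moebius_op_def wcomp_def on_ball_def flip: mult.assoc)
qed

lemma bounded_moebius_op: "bounded_operator H ip (moebius_op \<gamma> a)"
  using moebius_op_contraction
  by (intro bounded_operatorI[where C = 1]) (simp_all add: moebius_op_def wcomp_add wcomp_scale)

lemma unitary_moebius_op: "unitary_operator H ip (moebius_op \<gamma> a)"
proof -
  have "moebius_op \<gamma> a ` H = H"
    using moebius_op_contraction(1) moebius_op_moebius_op by force
  then show ?thesis
    by (simp add: unitary_operator_def bounded_moebius_op moebius_op_adjoint
        moebius_op_contraction moebius_op_moebius_op)
qed

end

end

section \<open>Linear functions in the kernel space\<close>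

text \<open>Up to the factor \<open>\<gamma>\<close> this is the vector that represents the
  derivative at the origin in direction \<open>a\<close>. It is cut off because members of
  \<open>H\<close> vanish off the ball, and it is antilinear in \<open>a\<close>.\<close>

definition lin_fun :: "complex ^ 'n \<Rightarrow> complex ^ 'n \<Rightarrow> complex" where
  "lin_fun a = on_ball (\<lambda>w. hdot w a)"

lemma tendsto_difference_quotient:
  fixes g :: "complex \<Rightarrow> complex"
  assumes "(g has_field_derivative d) (at 0)" "s \<longlonglongrightarrow> 0" "\<And>n. s n \<noteq> 0"
  shows "(\<lambda>n. (g (s n) - g 0) / s n) \<longlonglongrightarrow> d"
proof -
  have "((\<lambda>h. (g h - g 0) / h) \<longlongrightarrow> d) (at 0)"
    using assms(1) by (simp add: DERIV_def)
  moreover have "filterlim s (at 0) sequentially"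
    using assms(2,3) by (simp add: filterlim_at)
  ultimately show ?thesis
    by (rule filterlim_compose)
qed

lemma bounded_linear_scale_vec: "bounded_linear (\<lambda>s. s *s a)" for a :: "complex ^ 'n"
  by (intro linear_conv_bounded_linear[THEN iffD1] linearI)
    (simp_all add: vec_eq_iff algebra_simps)

lemma has_field_derivative_along_line:
  fixes h :: "complex ^ 'n \<Rightarrow> complex"
  assumes D: "(h has_derivative D) (at 0)" and lin: "\<And>c v. D (c *s v) = c * D v"
  shows "((\<lambda>s. h (s *s a)) has_field_derivative D a) (at 0)"
proof -
  have "((\<lambda>s. h (s *s a)) has_derivative (\<lambda>s. D (s *s a))) (at 0)"
    by (rule has_derivative_compose[OF bounded_linear_imp_has_derivative[OF bounded_linear_scale_vec]])
      (simp add: D)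
  moreover have "(\<lambda>s. D (s *s a)) = (*) (D a)"
    by (simp add: fun_eq_iff lin mult.commute)
  ultimately show ?thesis
    by (simp only: has_field_derivative_def)
qed

lemma one_minus_powr_has_field_derivative:
  "((\<lambda>s. (1 - s * c) powr (- complex_of_real \<gamma>)) has_field_derivative complex_of_real \<gamma> * c) (at 0)"
  by (auto intro!: derivative_eq_intros)

lemma bounded_linear_hdot: "bounded_linear (\<lambda>w. hdot w a)"
proof -
  have "linear (\<lambda>w. hdot w a)"
    by (rule linearI) (simp_all add: hdot_add_left scaleR_eq_scale hdot_scale_left scaleR_conv_of_real)
  then show ?thesis by (simp add: linear_conv_bounded_linear)
qed

lemma lin_fun_has_derivative: "(lin_fun a has_derivative (\<lambda>w. hdot w a)) (at 0)"
proof (rule has_derivative_transform_within_open[OF _ open_ball[of 0 1]])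
  show "((\<lambda>w. hdot w a) has_derivative (\<lambda>w. hdot w a)) (at 0)"
    by (rule bounded_linear_imp_has_derivative[OF bounded_linear_hdot])
qed (auto simp: lin_fun_def on_ball_def)

context kernel_space
begin

lemma ip_right_eqI:
  assumes "x \<in> H" "y \<in> H" "\<And>h. h \<in> H \<Longrightarrow> ip h x = ip h y"
  shows "x = y"
proof -
  have "ip (\<lambda>z. x z - y z) (\<lambda>z. x z - y z) = 0"
    using assms(3)[OF diff_mem[OF assms(1,2)]] assms(1,2) by (simp add: ip_diff_right diff_mem)
  then have "(\<lambda>z. x z - y z) = (\<lambda>_. 0)"
    using ip_pos[OF diff_mem[OF assms(1,2)]] by auto
  then show ?thesis by (simp add: fun_eq_iff)
qed

text \<open>\<open>\<gamma> * lin_fun a\<close> is the limit of the difference quotients \<open>(K\<^bsub>ta\<^esub> - K\<^sub>0) / t\<close>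
  for real \<open>t\<close> tending to \<open>0\<close>.\<close>

lemma lin_fun:
  fixes a :: "complex ^ 'n"
  assumes \<gamma>: "0 < \<gamma>"
  shows "lin_fun a \<in> H"
    and "h \<in> H \<Longrightarrow> (h has_derivative D) (at 0) \<Longrightarrow> (\<And>c v. D (c *s v) = c * D v) \<Longrightarrow>
      ip h (lin_fun a) = D a / complex_of_real \<gamma>"
proof -
  \<comment> \<open>The factor \<open>inverse (1 + norm a)\<close> keeps every point
    \<open>t n * a\<close> inside the ball.\<close>
  define t :: "nat \<Rightarrow> real" where "t n = inverse (real (Suc n)) * inverse (1 + norm a)" for n
  define s where "s n = complex_of_real (t n)" for n
  have pos: "0 < 1 + norm a" by (simp add: add_pos_nonneg)
  have t_pos: "0 < t n" for n using pos by (simp add: t_def)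
  have t_le: "t n \<le> 1" for n
    unfolding t_def by (intro mult_le_one) (auto simp: inverse_le_1_iff)
  have t_lim: "t \<longlonglongrightarrow> 0"
    unfolding t_def using tendsto_mult_left_zero[OF LIMSEQ_inverse_real_of_nat] by simp
  have s_nz: "s n \<noteq> 0" for n using t_pos[of n] by (simp add: s_def)
  have s_lim: "s \<longlonglongrightarrow> 0"
    unfolding s_def using tendsto_of_real[OF t_lim] by simp
  have sa: "s n *s a \<in> unit_ball" for n
  proof -
    have "norm (s n *s a) = t n * norm a"
      using t_pos[of n] by (simp add: s_def flip: scaleR_eq_scale)
    also have "\<dots> \<le> inverse (1 + norm a) * norm a"
      unfolding t_def using pos by (intro mult_right_mono mult_left_le_one_le) (auto simp: inverse_le_1_iff)
    also have "\<dots> < 1"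
      using pos by (simp add: field_simps)
    finally show ?thesis by simp
  qed
  have zero_ball: "(0 :: complex ^ 'n) \<in> unit_ball" by simp
  define X where "X n = (\<lambda>w. (1 / s n) * (kern \<gamma> (s n *s a) w - kern \<gamma> 0 w))" for n
  have X: "X n \<in> H" for n
    unfolding X_def by (intro scale_mem diff_mem kern_mem sa zero_ball)
  have ip_X: "ip h (X n) = (h (s n *s a) - h 0) / s n" if "h \<in> H" for h n
  proof -
    have "ip h (X n) = cnj (1 / s n) * (ip h (kern \<gamma> (s n *s a)) - ip h (kern \<gamma> 0))"
      using that unfolding X_def
      by (simp only: ip_scale_right ip_diff_right kern_mem sa zero_ball diff_mem)
    also have "\<dots> = cnj (1 / s n) * (h (s n *s a) - h 0)"
      using that by (simp only: reproducing sa zero_ball)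
    finally show ?thesis by (simp add: s_def)
  qed
  \<comment> \<open>One function of a complex variable governs both the pointwise values of
    \<open>X n\<close> and the inner products of \<open>X m\<close> with \<open>X n\<close>. Its
    limit at 0 is the derivative of the binomial power.\<close>
  define q where "q c u = ((1 - u * c) powr (- complex_of_real \<gamma>) - 1) / u" for c u :: complex
  have X_eq: "X n w = q (hdot w a) (s n)" if "w \<in> unit_ball" for n w
    using that by (simp add: X_def q_def kern_eq hdot_scale_right s_def)
  define N where "N = hdot a a"
  have "X m (s n *s a) - X m 0 = s n * q N (s m * s n)" for m n
    using s_nz[of n] s_nz[of m] unfolding X_eq[OF sa] X_eq[OF zero_ball]
    by (simp add: q_def hdot_scale_left N_def mult.assoc)
  then have ip_XX: "ip (X m) (X n) = q N (s m * s n)" for m n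
    using s_nz[of n] by (simp add: ip_X[OF X])
  have q_lim: "(\<lambda>n. q c (u n)) \<longlonglongrightarrow> complex_of_real \<gamma> * c"
    if "u \<longlonglongrightarrow> 0" "\<And>n. u n \<noteq> 0" for c u
    using tendsto_difference_quotient[OF one_minus_powr_has_field_derivative that, of c \<gamma>]
    by (simp add: q_def)
  have q_at: "((\<lambda>u. q N u) \<longlongrightarrow> complex_of_real \<gamma> * N) (at 0)"
    using one_minus_powr_has_field_derivative[of N \<gamma>] by (simp add: DERIV_def q_def)
  have cauchy: "\<forall>e>0. \<exists>M. \<forall>m\<ge>M. \<forall>n\<ge>M. hnorm ip (\<lambda>x. X m x - X n x) < e"
  proof (intro allI impI)
    fix e :: real assume e: "0 < e"
    obtain d where d: "0 < d" and qd: "\<And>u. u \<noteq> 0 \<Longrightarrow> cmod u < d \<Longrightarrow>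
        cmod (q N u - complex_of_real \<gamma> * N) < e\<^sup>2 / 4"
      \<comment> \<open>The quarter is chosen because the expansion of the squared norm of
        \<open>X m - X n\<close> has coefficients 1, -2, 1, of total size 4, and all its terms tend
        to the same limit.\<close>
      using LIM_D[OF q_at, of "e\<^sup>2 / 4"] e by auto
    obtain M where M: "\<And>n. n \<ge> M \<Longrightarrow> t n < d"
      using order_tendstoD(2)[OF t_lim d] by (auto simp: eventually_sequentially)
    have near: "cmod (q N (s m * s n) - complex_of_real \<gamma> * N) < e\<^sup>2 / 4" if "m \<ge> M" for m n
    proof (rule qd)
      show "s m * s n \<noteq> 0" using s_nz by simp
      have "cmod (s m * s n) = t m * t n"
        using t_pos[of m] t_pos[of n] by (simp add: s_def norm_mult)
      also have "\<dots> \<le> t m * 1"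
        using t_le t_pos[of m] by (intro mult_left_mono) auto
      also have "\<dots> < d" using M[OF that] by simp
      finally show "cmod (s m * s n) < d" .
    qed
    have Re_near: "\<bar>Re (q N (s m * s n)) - Re (complex_of_real \<gamma> * N)\<bar> < e\<^sup>2 / 4" if "m \<ge> M" for m n
      using abs_Re_le_cmod[of "q N (s m * s n) - complex_of_real \<gamma> * N"] near[OF that, of n]
      by (simp only: minus_complex.sel)
    show "\<exists>M. \<forall>m\<ge>M. \<forall>n\<ge>M. hnorm ip (\<lambda>x. X m x - X n x) < e"
    proof (intro exI[of _ M] allI impI)
      fix m n assume mn: "M \<le> m" "M \<le> n"
      have "(hnorm ip (\<lambda>x. X m x - X n x))\<^sup>2 =
          Re (q N (s m * s m)) - 2 * Re (q N (s m * s n)) + Re (q N (s n * s n))"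
        by (simp add: hnorm_diff_sq X hnorm_sq ip_XX)
      also have "\<dots> < e\<^sup>2"
        using Re_near[OF mn(1), of m] Re_near[OF mn(1), of n] Re_near[OF mn(2), of n]
        unfolding abs_less_iff by linarith
      finally show "hnorm ip (\<lambda>x. X m x - X n x) < e"
        by (rule power2_less_imp_less) (simp add: e less_imp_le)
    qed
  qed
  obtain L where L: "L \<in> H" and lim: "(\<lambda>n. hnorm ip (\<lambda>x. X n x - L x)) \<longlonglongrightarrow> 0"
    using complete[OF X cauchy] by blast
  have L_eq: "L w = complex_of_real \<gamma> * hdot w a" if w: "w \<in> unit_ball" for w
  proof (rule LIMSEQ_unique)
    show "(\<lambda>n. X n w) \<longlonglongrightarrow> L w"
      using tendsto_ip[OF X L kern_mem[OF w] lim] by (simp only: reproducing[symmetric] X L w)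
    show "(\<lambda>n. X n w) \<longlonglongrightarrow> complex_of_real \<gamma> * hdot w a"
      unfolding X_eq[OF w] using s_lim s_nz by (rule q_lim)
  qed
  have lin_eq: "lin_fun a = (\<lambda>w. complex_of_real (1 / \<gamma>) * L w)"
    using \<gamma> L_eq zero_off_ball[OF L] by (auto simp: fun_eq_iff lin_fun_def on_ball_def)
  show "lin_fun a \<in> H"
    unfolding lin_eq using L by (rule scale_mem)
  show "ip h (lin_fun a) = D a / complex_of_real \<gamma>"
    if h: "h \<in> H" and D: "(h has_derivative D) (at 0)" and Dlin: "\<And>c v. D (c *s v) = c * D v"
  proof -
    have "ip h L = D a"
    proof (rule LIMSEQ_unique)
      show "(\<lambda>n. ip h (X n)) \<longlonglongrightarrow> ip h L"
        by (rule tendsto_ip_right[OF X L h lim])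
      show "(\<lambda>n. ip h (X n)) \<longlonglongrightarrow> D a"
        unfolding ip_X[OF h]
        using tendsto_difference_quotient[OF has_field_derivative_along_line[OF D Dlin] s_lim s_nz]
        by simp
    qed
    then show ?thesis
      unfolding lin_eq using ip_scale_right[OF L h, of "complex_of_real (1 / \<gamma>)"] by simp
  qed
qed

lemma ip_lin_fun:
  fixes a b :: "complex ^ 'n"
  assumes "0 < \<gamma>"
  shows "ip (lin_fun a) (lin_fun b) = hdot b a / complex_of_real \<gamma>"
  by (rule lin_fun(2)[OF assms lin_fun(1)[OF assms] lin_fun_has_derivative]) (rule hdot_scale_left)

lemma lin_fun_inject:
  fixes a b :: "complex ^ 'n"
  assumes "0 < \<gamma>" "lin_fun a = lin_fun b"
  shows "a = b"
proof (rule hdot_eqI_right)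
  fix w
  show "hdot w a = hdot w b"
    using ip_lin_fun[OF assms(1), of a w] ip_lin_fun[OF assms(1), of b w] assms by simp
qed

end

section \<open>Normal operators\<close>

context hilbert_function_space
begin

lemma normal_operator_cong:
  assumes "normal_operator H ip T" "\<And>h. h \<in> H \<Longrightarrow> T' h = T h"
  shows "normal_operator H ip T'"
proof -
  have "bounded_operator H ip T'"
    using assms by (simp add: normal_operator_def bounded_operator_def add_mem scale_mem)
  moreover obtain S where "bounded_operator H ip S"
      "\<And>g h. g \<in> H \<Longrightarrow> h \<in> H \<Longrightarrow> ip (T g) h = ip g (S h)" "\<And>h. h \<in> H \<Longrightarrow> T (S h) = S (T h)"
    using assms(1) unfolding normal_operator_def by blast
  ultimately show ?thesis
    unfolding normal_operator_def using assms(2)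
    by (intro conjI exI[of _ S]) (auto simp: bounded_operator_def)
qed

lemma bounded_operator_compose:
  assumes "bounded_operator H ip T" "bounded_operator H ip S"
  shows "bounded_operator H ip (\<lambda>h. T (S h))"
proof -
  obtain C where C: "\<And>h. h \<in> H \<Longrightarrow> hnorm ip (T h) \<le> C * hnorm ip h"
    using assms(1) unfolding bounded_operator_def by blast
  obtain C' where C': "\<And>h. h \<in> H \<Longrightarrow> hnorm ip (S h) \<le> C' * hnorm ip h"
    using assms(2) unfolding bounded_operator_def by blast
  have S: "S h \<in> H" if "h \<in> H" for h using assms(2) that by (simp add: bounded_operator_def)
  have "hnorm ip (T (S h)) \<le> (\<bar>C\<bar> * C') * hnorm ip h" if h: "h \<in> H" for h
  proof -
    have "hnorm ip (T (S h)) \<le> C * hnorm ip (S h)" using C S[OF h] .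
    also have "\<dots> \<le> \<bar>C\<bar> * hnorm ip (S h)"
      using hnorm_nonneg[OF S[OF h]] by (intro mult_right_mono) auto
    also have "\<dots> \<le> \<bar>C\<bar> * (C' * hnorm ip h)"
      using C'[OF h] by (intro mult_left_mono) auto
    finally show ?thesis by (simp add: mult.assoc)
  qed
  then show ?thesis
    using assms S unfolding bounded_operator_def by (auto simp: add_mem scale_mem)
qed

lemma normal_operator_conjugate:
  assumes T: "normal_operator H ip T" and U: "bounded_operator H ip U"
    and self: "\<And>g h. g \<in> H \<Longrightarrow> h \<in> H \<Longrightarrow> ip (U g) h = ip g (U h)"
    and inv: "\<And>h. h \<in> H \<Longrightarrow> U (U h) = h"
  shows "normal_operator H ip (\<lambda>h. U (T (U h)))"
proof -
  obtain S where S: "bounded_operator H ip S"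
      and adj: "\<And>g h. g \<in> H \<Longrightarrow> h \<in> H \<Longrightarrow> ip (T g) h = ip g (S h)"
      and comm: "\<And>h. h \<in> H \<Longrightarrow> T (S h) = S (T h)"
    using T unfolding normal_operator_def by blast
  have T': "bounded_operator H ip T" using T by (simp add: normal_operator_def)
  have mem: "U h \<in> H" "T h \<in> H" "S h \<in> H" if "h \<in> H" for h
    using U S T' that by (simp_all add: bounded_operator_def)
  show ?thesis
    unfolding normal_operator_def
  proof (intro conjI exI[of _ "\<lambda>h. U (S (U h))"] ballI)
    show "bounded_operator H ip (\<lambda>h. U (T (U h)))" "bounded_operator H ip (\<lambda>h. U (S (U h)))"
      using bounded_operator_compose[OF U bounded_operator_compose[OF T' U]]
        bounded_operator_compose[OF U bounded_operator_compose[OF S U]] by simp_all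
  qed (simp_all add: mem self adj inv comm)
qed

lemma normal_operator_scale:
  assumes T: "bounded_operator H ip T" and S: "bounded_operator H ip S"
    and adj: "\<And>g h. g \<in> H \<Longrightarrow> h \<in> H \<Longrightarrow> ip (T g) h = ip g (S h)"
    and comm: "\<And>h. h \<in> H \<Longrightarrow> T (S h) = S (T h)"
  shows "normal_operator H ip (\<lambda>h z. c * T h z)"
proof -
  have mem: "T h \<in> H" "S h \<in> H" if "h \<in> H" for h
    using S T that by (simp_all add: bounded_operator_def)
  have scaled: "bounded_operator H ip (\<lambda>h z. d * R h z)" if R: "bounded_operator H ip R" for d R
  proof -
    obtain C where C: "\<And>h. h \<in> H \<Longrightarrow> hnorm ip (R h) \<le> C * hnorm ip h"
      using R unfolding bounded_operator_def by blast
    have "hnorm ip (\<lambda>z. d * R h z) \<le> (cmod d * C) * hnorm ip h" if "h \<in> H" for h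
      using mult_left_mono[OF C[OF that], of "cmod d"] R that
      by (simp add: hnorm_scale bounded_operator_def mult.assoc)
    then show ?thesis
      using R unfolding bounded_operator_def by (auto simp: scale_mem distrib_left mult.left_commute)
  qed
  have "T (\<lambda>z. d * h z) = (\<lambda>z. d * T h z)" "S (\<lambda>z. d * h z) = (\<lambda>z. d * S h z)" if "h \<in> H" for h d
    using T S that by (simp_all add: bounded_operator_def)
  then show ?thesis
    unfolding normal_operator_def
    by (intro conjI exI[of _ "\<lambda>h z. cnj c * S h z"] scaled T S ballI)
      (simp_all add: mem ip_scale ip_scale_right adj comm mult.left_commute)
qed

context
  fixes T S
  assumes T: "bounded_operator H ip T" and S: "bounded_operator H ip S"
    and adj: "\<And>g h. g \<in> H \<Longrightarrow> h \<in> H \<Longrightarrow> ip (T g) h = ip g (S h)"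
    and comm: "\<And>h. h \<in> H \<Longrightarrow> T (S h) = S (T h)"
begin

lemma normal_hnorm_adjoint:
  assumes h: "h \<in> H"
  shows "hnorm ip (T h) = hnorm ip (S h)"
proof -
  have mem: "T h \<in> H" "S h \<in> H" if "h \<in> H" for h
    using S T that by (simp_all add: bounded_operator_def)
  have "ip (T h) (T h) = ip h (T (S h))"
    using h by (simp add: adj mem comm)
  also have "\<dots> = cnj (ip (T (S h)) h)"
    using h by (intro ip_commute) (simp_all add: mem)
  also have "\<dots> = cnj (ip (S h) (S h))"
    using h by (simp add: adj mem)
  finally show ?thesis by (simp add: hnorm_def)
qed

text \<open>Expanding the squared norm of \<open>T k - c * k\<close> gives
  \<open>(hnorm ip (S k))\<^sup>2 - (cmod c * hnorm ip k)\<^sup>2\<close>, because \<open>T\<close>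
  and \<open>S\<close> have equal norms on \<open>k\<close>. The eigenvector equation makes this
  zero.\<close>

lemma normal_eigenvector_adjoint:
  assumes k: "k \<in> H" and eig: "S k = (\<lambda>x. cnj c * k x)"
  shows "T k = (\<lambda>x. c * k x)"
proof -
  have Tk: "T k \<in> H" using T k by (simp add: bounded_operator_def)
  have "ip (T k) (\<lambda>x. c * k x) = complex_of_real ((cmod c * hnorm ip k)\<^sup>2)"
    using k Tk complex_norm_square[of c]
    by (simp add: ip_scale_right adj eig ip_self power_mult_distrib mult_ac)
  moreover have "hnorm ip (T k) = cmod c * hnorm ip k"
    using normal_hnorm_adjoint[OF k] k by (simp add: eig hnorm_scale)
  ultimately have "(hnorm ip (\<lambda>x. T k x - c * k x))\<^sup>2 = 0"
    using k Tk by (simp add: hnorm_diff_sq scale_mem hnorm_scale del: of_real_power)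
  then have "(\<lambda>x. T k x - c * k x) = (\<lambda>_. 0)"
    using hnorm_eq_0D[OF diff_mem[OF Tk scale_mem[OF k]]] by simp
  then show ?thesis by (simp add: fun_eq_iff)
qed

end

end

section \<open>Composition with contractions\<close>

lemma comp_op_eq_wcomp: "comp_op A = wcomp (\<lambda>_. 1) A"
  by (simp add: comp_op_def wcomp_def fun_eq_iff)

lemma adjoint_contraction:
  assumes adj: "\<And>z w. hdot (A z) w = hdot z (B w)"
    and contr: "\<And>x. norm (A x) \<le> norm x"
  shows "norm (B x) \<le> norm x"
proof (cases "B x = 0")
  case False
  have "complex_of_real ((norm (B x))\<^sup>2) = hdot (A (B x)) x"
    by (simp only: adj hdot_self)
  then have "(norm (B x))\<^sup>2 = cmod (hdot (A (B x)) x)"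
    by (metis abs_of_nonneg norm_of_real zero_le_power2)
  also have "\<dots> \<le> norm (B x) * norm x"
    using norm_hdot_le[of "A (B x)" x] contr[of "B x"]
    by (meson mult_right_mono norm_ge_zero order_trans)
  finally show ?thesis using False by (simp add: power2_eq_square)
qed simp

text \<open>The adjoint of composition with \<open>A\<close> must send the kernel at
  \<open>z\<close> to the kernel at \<open>A z\<close>; composition with \<open>B\<close> does so
  because \<open>hdot (B w) z = hdot w (A z)\<close>. The factor \<open>cnj 1\<close> only matches
  the general form with weight \<open>f\<close>.\<close>

lemma comp_op_kern:
  assumes adj: "\<And>z w. hdot (A z) w = hdot z (B w)"
    and contr: "\<And>x. norm (B x) \<le> norm x"
  shows "wcomp (\<lambda>_. 1) B (kern \<gamma> z) = (\<lambda>w. cnj 1 * kern \<gamma> (A z) w)"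
proof
  fix w
  have "hdot (B w) z = hdot w (A z)"
    using arg_cong[OF adj[of z w], of cnj] by (simp only: cnj_hdot)
  moreover have "B w \<in> unit_ball" if "w \<in> unit_ball"
    using contr[of w] that by simp
  ultimately show "wcomp (\<lambda>_. 1) B (kern \<gamma> z) w = cnj 1 * kern \<gamma> (A z) w"
    by (simp add: wcomp_def kern_def on_ball_def)
qed

context kernel_space
begin

lemma comp_op_contraction:
  assumes \<gamma>: "0 < \<gamma>" and lin: "Vector_Spaces.linear (*s) (*s) A"
    and adj: "\<And>z w. hdot (A z) w = hdot z (B w)"
    and contr: "\<And>x. norm (A x) \<le> norm x" and h: "h \<in> H"
  shows "comp_op A h \<in> H" "hnorm ip (comp_op A h) \<le> hnorm ip h"
proof -
  have self: "A z \<in> unit_ball" if "z \<in> unit_ball" for z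
    using contr[of z] that by simp
  have psd: "psd (\<lambda>z w. kern \<gamma> z w - cnj 1 * 1 * kern \<gamma> (A z) (A w))"
    using psd_kern_diff_contraction[OF \<gamma> lin contr] by simp
  note kern = comp_op_kern[of A B \<gamma>, OF adj adjoint_contraction[OF adj contr]]
  show "comp_op A h \<in> H" "hnorm ip (comp_op A h) \<le> hnorm ip h"
    unfolding comp_op_eq_wcomp
    by (rule wcomp_contraction[of A "\<lambda>_. 1" B "\<lambda>_. 1", OF self kern psd h]; simp)+
qed

lemma normal_comp_op:
  assumes \<gamma>: "0 < \<gamma>" and A: "normal_linear A" and contr: "\<And>x. norm (A x) \<le> norm x"
  shows "normal_operator H ip (\<lambda>h z. c * comp_op A h z)"
proof -
  have linA: "Vector_Spaces.linear (*s) (*s) A" using A by (simp add: normal_linear_def)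
  obtain B where linB: "Vector_Spaces.linear (*s) (*s) B"
      and adj: "\<And>z w. hdot (A z) w = hdot z (B w)" and comm: "A \<circ> B = B \<circ> A"
    using A unfolding normal_linear_def by blast
  have adj': "hdot (B z) w = hdot z (A w)" for z w
    using arg_cong[OF adj[of w z], of cnj] by (simp only: cnj_hdot)
  have contrB: "norm (B x) \<le> norm x" for x
    by (rule adjoint_contraction[OF adj contr])
  note CA = comp_op_contraction[OF \<gamma> linA adj contr]
  note CB = comp_op_contraction[OF \<gamma> linB adj' contrB]
  have bounded: "bounded_operator H ip (comp_op A)" "bounded_operator H ip (comp_op B)"
    using CA CB by (intro bounded_operatorI[where C = 1];
      simp add: comp_op_eq_wcomp wcomp_add wcomp_scale)+
  have self: "B z \<in> unit_ball" if "z \<in> unit_ball" for z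
    using contrB[of z] that by simp
  have "ip (comp_op A g) h = ip g (comp_op B h)" if "g \<in> H" "h \<in> H" for g h
    using CA that unfolding comp_op_eq_wcomp
    by (intro wcomp_adjoint self comp_op_kern[OF adj' contr]) simp_all
  moreover have "comp_op A (comp_op B h) = comp_op B (comp_op A h)" for h
  proof
    fix z
    have "B (A z) = A (B z)" using fun_cong[OF comm, of z] by simp
    then show "comp_op A (comp_op B h) z = comp_op B (comp_op A h) z"
      using contr[of z] contrB[of z] by (simp add: comp_op_def on_ball_def)
  qed
  ultimately show ?thesis
    using bounded by (intro normal_operator_scale[where S = "comp_op B"]) simp_all
qed

end

text \<open>Conjugation multiplies the weights at \<open>z\<close> and at
  \<open>w = \<psi> (moebius p z)\<close>. The second is the reciprocal of the weight at
  \<open>moebius p w\<close>, which produces the quotient of normalized kernels in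
  \<open>moebius_linear_form\<close>.\<close>

lemma moebius_conjugate_eq:
  assumes p: "p \<in> unit_ball" and self: "\<And>z. z \<in> unit_ball \<Longrightarrow> \<psi> z \<in> unit_ball"
    and z: "z \<in> unit_ball"
  shows "moebius_op \<gamma> p (\<lambda>z. c * comp_op \<psi> (moebius_op \<gamma> p h) z) z =
    c * (nkern \<gamma> p z / nkern \<gamma> p (moebius p (\<psi> (moebius p z)))) * h (moebius p (\<psi> (moebius p z)))"
proof -
  define w where "w = \<psi> (moebius p z)"
  have mz: "moebius p z \<in> unit_ball" using p z by (rule moebius_in_ball)
  then have w: "w \<in> unit_ball" unfolding w_def by (rule self)
  have "nkern \<gamma> p w = 1 / nkern \<gamma> p (moebius p w)"
    using nkern_mult_moebius[OF p w] by (metis nonzero_eq_divide_eq mult_zero_right zero_neq_one)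
  then show ?thesis
    using z mz w by (simp add: moebius_op_def comp_op_def wcomp_def on_ball_def flip: w_def)
qed

section \<open>Normal composition operators fixing the origin\<close>

lemma norm_vec_sq: "(norm x)\<^sup>2 = (\<Sum>i\<in>UNIV. (cmod (x $ i))\<^sup>2)" for x :: "complex ^ 'n"
  by (simp add: norm_vec_def L2_set_def sum_nonneg)

lemma hdot_axis: "hdot z (axis i 1) = z $ i"
proof -
  have "hdot z (axis i 1) = (\<Sum>j\<in>UNIV. if j = i then z $ j else 0)"
    unfolding hdot_def by (intro sum.cong refl) (simp add: axis_def)
  then show ?thesis by simp
qed

lemma clinear_has_adjoint:
  fixes B :: "complex ^ 'n \<Rightarrow> complex ^ 'n"
  assumes lin: "Vector_Spaces.linear (*s) (*s) B"
  obtains B' where "Vector_Spaces.linear (*s) (*s) B'" "\<And>z w. hdot (B z) w = hdot z (B' w)"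
proof
  define B' where "B' w = (\<chi> j. hdot w (B (axis j 1)))" for w
  show "Vector_Spaces.linear (*s) (*s) B'"
    by (simp add: clinear_iff B'_def vec_eq_iff hdot_add_left hdot_scale_left)
  show "hdot (B z) w = hdot z (B' w)" for z w
  proof -
    have B0: "B 0 = 0"
      using lin clinear_iff[of B] by (metis vec.scale_zero_left)
    have "B (\<Sum>j\<in>J. z $ j *s axis j 1) = (\<Sum>j\<in>J. z $ j *s B (axis j 1))" for J
      using lin by (induction J rule: infinite_finite_induct) (simp_all add: B0 clinear_iff)
    then have "B z = (\<Sum>j\<in>UNIV. z $ j *s B (axis j 1))"
      by (metis basis_expansion)
    then have "hdot (B z) w = (\<Sum>j\<in>UNIV. z $ j * hdot (B (axis j 1)) w)"
      by (simp only: hdot_sum_left hdot_scale_left)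
    then show ?thesis
      by (simp add: hdot_def[of z] B'_def cnj_hdot)
  qed
qed

text \<open>Both sums are the squared Hilbert-Schmidt norm.\<close>

lemma sum_norm_adjoint:
  assumes adj: "\<And>z w. hdot (B z) w = hdot z (B' w)"
  shows "(\<Sum>j\<in>UNIV. (norm (B (axis j 1)))\<^sup>2) = (\<Sum>j\<in>UNIV. (norm (B' (axis j 1)))\<^sup>2)"
proof -
  have "B (axis j 1) $ i = cnj (B' (axis i 1) $ j)" for i j
  proof -
    have "B (axis j 1) $ i = hdot (axis j 1) (B' (axis i 1))"
      by (simp add: hdot_axis flip: adj)
    also have "\<dots> = cnj (hdot (B' (axis i 1)) (axis j 1))"
      by (simp only: cnj_hdot)
    finally show ?thesis by (simp only: hdot_axis)
  qed
  then have "(\<Sum>j\<in>UNIV. (norm (B (axis j 1)))\<^sup>2) =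
      (\<Sum>j\<in>UNIV. \<Sum>i\<in>UNIV. (cmod (B' (axis i 1) $ j))\<^sup>2)"
    by (simp add: norm_vec_sq)
  also have "\<dots> = (\<Sum>i\<in>UNIV. \<Sum>j\<in>UNIV. (cmod (B' (axis i 1) $ j))\<^sup>2)"
    by (rule sum.swap)
  finally show ?thesis by (simp add: norm_vec_sq)
qed

text \<open>If \<open>norm (B z)\<close> exceeded \<open>norm z\<close>, dividing \<open>z\<close>
  by \<open>norm (B z)\<close> would give a point of the ball whose image lies on the unit
  sphere.\<close>

lemma clinear_self_map_contraction:
  fixes B :: "complex ^ 'n \<Rightarrow> complex ^ 'n"
  assumes lin: "Vector_Spaces.linear (*s) (*s) B"
    and self: "\<And>z. z \<in> unit_ball \<Longrightarrow> B z \<in> unit_ball"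
  shows "norm (B z) \<le> norm z"
proof (rule ccontr)
  assume less: "\<not> norm (B z) \<le> norm z"
  then have pos: "0 < norm (B z)"
    using norm_ge_zero[of z] by linarith
  define r where "r = 1 / norm (B z)"
  have "norm (r *\<^sub>R z) < 1"
    using less pos by (simp add: r_def)
  then have "norm (B (r *\<^sub>R z)) < 1"
    using self[of "r *\<^sub>R z"] by simp
  moreover have "B (r *\<^sub>R z) = r *\<^sub>R B z"
    using lin by (simp only: clinear_iff scaleR_eq_scale)
  ultimately show False using pos by (simp add: r_def)
qed

lemma has_derivative_vec_lambda:
  fixes f :: "'n :: finite \<Rightarrow> complex ^ 'm \<Rightarrow> complex"
  assumes "\<And>i. (f i has_derivative D i) (at x)"
  shows "((\<lambda>z. \<chi> i. f i z) has_derivative (\<lambda>v. \<chi> i. D i v)) (at x)"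
proof -
  have sum: "(\<chi> i. g i) = (\<Sum>i\<in>UNIV. axis i (g i))" for g :: "'n \<Rightarrow> complex"
  proof (rule vec_eq_iff[THEN iffD2], rule allI)
    fix j
    have "(\<Sum>i\<in>UNIV. axis i (g i) $ j) = (\<Sum>i\<in>UNIV. if i = j then g i else 0)"
      by (intro sum.cong refl) (auto simp: axis_def)
    then show "(\<chi> i. g i) $ j = (\<Sum>i\<in>UNIV. axis i (g i)) $ j" by simp
  qed
  have axis: "bounded_linear (axis i :: complex \<Rightarrow> complex ^ 'n)" for i
    by (intro linear_conv_bounded_linear[THEN iffD1] linearI) (auto simp: vec_eq_iff axis_def)
  show ?thesis
    unfolding sum by (rule has_derivative_sum) (rule bounded_linear.has_derivative[OF axis assms])
qed

context kernel_space
begin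

text \<open>The adjoint of \<open>T\<close> maps \<open>lin_fun a\<close> to a multiple of \<open>lin_fun (B a)\<close>, where \<open>B\<close> is the
  derivative of \<open>\<psi>\<close> at \<open>0\<close>, and \<open>T (lin_fun a)\<close> projects to a multiple of \<open>lin_fun (B' a)\<close>.
  Normality and the equality of the Hilbert-Schmidt norms of \<open>B\<close> and \<open>B'\<close> force
  \<open>T (lin_fun a)\<close> to equal its projection, which makes \<open>\<psi>\<close> linear.\<close>

lemma normal_composition_linear:
  assumes \<gamma>: "0 < \<gamma>" and normal: "normal_operator H ip T" and \<alpha>: "\<alpha> \<noteq> 0"
    and T_eq: "\<And>h z. h \<in> H \<Longrightarrow> z \<in> unit_ball \<Longrightarrow> T h z = \<alpha> * h (\<psi> z)"
    and self: "\<And>z. z \<in> unit_ball \<Longrightarrow> \<psi> z \<in> unit_ball" and \<psi>0: "\<psi> 0 = 0"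
  obtains B where "normal_linear B" "\<And>z. norm (B z) \<le> norm z" "\<And>z. z \<in> unit_ball \<Longrightarrow> \<psi> z = B z"
proof -
  have T: "bounded_operator H ip T" using normal by (simp add: normal_operator_def)
  obtain S where S: "bounded_operator H ip S"
      and adj: "\<And>g h. g \<in> H \<Longrightarrow> h \<in> H \<Longrightarrow> ip (T g) h = ip g (S h)"
      and comm: "\<And>h. h \<in> H \<Longrightarrow> T (S h) = S (T h)"
    using normal unfolding normal_operator_def by blast
  have mem: "T h \<in> H" "S h \<in> H" if "h \<in> H" for h
    using S T that by (simp_all add: bounded_operator_def)
  note lin_mem = lin_fun(1)[OF \<gamma>]
  have T_lin: "T (lin_fun a) z = \<alpha> * hdot (\<psi> z) a" if "z \<in> unit_ball" for a z
    using T_eq[OF lin_mem that] self[OF that] by (simp add: lin_fun_def on_ball_def)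
  \<comment> \<open>Differentiability of \<open>\<psi>\<close> is not assumed but read off from the
    operator: its coordinates are, up to \<open>\<alpha>\<close>, the images of the coordinate
    functions, and these images are analytic as members of \<open>H\<close>. Only on the ball does
    \<open>\<psi>'\<close> have to agree with \<open>\<psi>\<close>.\<close>
  define \<psi>' where "\<psi>' z = (\<chi> i. (1 / \<alpha>) * T (lin_fun (axis i 1)) z)" for z
  have \<psi>': "\<psi>' z = \<psi> z" if "z \<in> unit_ball" for z
    using \<alpha> that by (simp add: \<psi>'_def vec_eq_iff T_lin hdot_axis)
  have "analytic_on_ball (\<lambda>z. (1 / \<alpha>) * T (lin_fun (axis i 1)) z)" for i
    by (intro analytic scale_mem mem lin_mem)
  then have "\<exists>D. ((\<lambda>z. (1 / \<alpha>) * T (lin_fun (axis i 1)) z) has_derivative D) (at 0) \<and>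
      (\<forall>c v. D (c *s v) = c * D v)" for i
    unfolding analytic_on_ball_def by simp
  then obtain D where D: "\<And>i. ((\<lambda>z. (1 / \<alpha>) * T (lin_fun (axis i 1)) z) has_derivative D i) (at 0)"
      and D_scale: "\<And>i c v. D i (c *s v) = c * D i v"
    by metis
  define B where "B v = (\<chi> i. D i v)" for v
  have \<psi>'_deriv: "(\<psi>' has_derivative B) (at 0)"
    unfolding \<psi>'_def B_def using D by (rule has_derivative_vec_lambda)
  have linB: "Vector_Spaces.linear (*s) (*s) B"
    using linear_add[OF has_derivative_linear[OF D]]
    by (simp add: clinear_iff B_def vec_eq_iff D_scale)
  obtain B' where linB': "Vector_Spaces.linear (*s) (*s) B'"
      and B': "\<And>z w. hdot (B z) w = hdot z (B' w)"
    using clinear_has_adjoint[OF linB] by blast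
  have B'': "hdot (B' z) w = hdot z (B w)" for z w
    using arg_cong[OF B'[of w z], of cnj] by (simp only: cnj_hdot)
  \<comment> \<open>Pairing \<open>T h\<close> with \<open>lin_fun a\<close> differentiates
    \<open>T h\<close> at 0. Since \<open>\<psi>\<close> fixes the origin, the chain rule turns this
    into the derivative of \<open>h\<close> at the same point, in direction
    \<open>B a\<close>.\<close>
  have S_lin: "S (lin_fun a) = (\<lambda>x. cnj \<alpha> * lin_fun (B a) x)" for a
  proof (rule ip_right_eqI)
    fix h assume h: "h \<in> H"
    obtain D' where D': "(h has_derivative D') (at 0)" and D'_scale: "\<And>c v. D' (c *s v) = c * D' v"
      using analytic[OF h] unfolding analytic_on_ball_def by force
    have "((\<lambda>z. h (\<psi>' z)) has_derivative (\<lambda>v. D' (B v))) (at 0)"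
      by (rule has_derivative_compose[OF \<psi>'_deriv]) (simp add: \<psi>' \<psi>0 D')
    then have "((\<lambda>z. \<alpha> * h (\<psi>' z)) has_derivative (\<lambda>v. \<alpha> * D' (B v))) (at 0)"
      by (rule has_derivative_mult_right)
    then have "(T h has_derivative (\<lambda>v. \<alpha> * D' (B v))) (at 0)"
      by (rule has_derivative_transform_within_open[OF _ open_ball[of 0 1]])
        (simp_all add: T_eq h \<psi>')
    then have "ip (T h) (lin_fun a) = \<alpha> * D' (B a) / complex_of_real \<gamma>"
      using linB by (intro lin_fun(2)[OF \<gamma> mem(1)[OF h]]) (simp_all add: clinear_iff D'_scale)
    also have "\<dots> = \<alpha> * ip h (lin_fun (B a))"
      by (simp add: lin_fun(2)[OF \<gamma> h D' D'_scale])
    finally show "ip h (S (lin_fun a)) = ip h (\<lambda>x. cnj \<alpha> * lin_fun (B a) x)"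
      using h by (simp add: adj lin_mem ip_scale_right)
  qed (simp_all add: mem lin_mem scale_mem)
  have hnorm_lin: "(hnorm ip (lin_fun a))\<^sup>2 = (norm a)\<^sup>2 / \<gamma>" for a :: "complex ^ 'n"
    by (simp add: hnorm_sq lin_mem ip_lin_fun[OF \<gamma>] hdot_self del: of_real_power flip: of_real_divide)
  define d where "d a = (\<lambda>x. T (lin_fun a) x - \<alpha> * lin_fun (B' a) x)" for a
  have d_mem: "d a \<in> H" for a
    unfolding d_def by (intro diff_mem scale_mem mem lin_mem)
  have d_norm: "(hnorm ip (d a))\<^sup>2 = (cmod \<alpha>)\<^sup>2 / \<gamma> * ((norm (B a))\<^sup>2 - (norm (B' a))\<^sup>2)" for a
  proof -
    have "hnorm ip (T (lin_fun a)) = hnorm ip (S (lin_fun a))"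
      by (rule normal_hnorm_adjoint[OF T S adj comm lin_mem])
    then have 1: "(hnorm ip (T (lin_fun a)))\<^sup>2 = (cmod \<alpha>)\<^sup>2 * ((norm (B a))\<^sup>2 / \<gamma>)"
      by (simp add: S_lin hnorm_scale lin_mem power_mult_distrib hnorm_lin)
    have 2: "(hnorm ip (\<lambda>x. \<alpha> * lin_fun (B' a) x))\<^sup>2 = (cmod \<alpha>)\<^sup>2 * ((norm (B' a))\<^sup>2 / \<gamma>)"
      by (simp add: hnorm_scale lin_mem power_mult_distrib hnorm_lin)
    have "ip (T (lin_fun a)) (\<lambda>x. \<alpha> * lin_fun (B' a) x) =
        cnj \<alpha> * (\<alpha> * (hdot (B (B' a)) a / complex_of_real \<gamma>))"
      by (simp add: ip_scale_right mem lin_mem adj S_lin ip_lin_fun[OF \<gamma>])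
    also have "\<dots> = complex_of_real ((cmod \<alpha>)\<^sup>2 * ((norm (B' a))\<^sup>2 / \<gamma>))"
      using complex_norm_square[of \<alpha>] by (simp add: B' hdot_self)
    finally have 3: "Re (ip (T (lin_fun a)) (\<lambda>x. \<alpha> * lin_fun (B' a) x)) =
        (cmod \<alpha>)\<^sup>2 * ((norm (B' a))\<^sup>2 / \<gamma>)"
      by (simp only: Re_complex_of_real)
    show ?thesis
      unfolding d_def hnorm_diff_sq[OF mem(1)[OF lin_mem] scale_mem[OF lin_mem]] 1 2 3
      by (simp add: right_diff_distrib)
  qed
  have "(\<Sum>j\<in>UNIV. (hnorm ip (d (axis j 1)))\<^sup>2) = 0"
    unfolding d_norm sum_distrib_left[symmetric] sum_subtractf sum_norm_adjoint[OF B'] by simp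
  then have "hnorm ip (d (axis j 1)) = 0" for j
    by (subst (asm) sum_nonneg_eq_0_iff) auto
  then have "d (axis j 1) = (\<lambda>_. 0)" for j
    using hnorm_eq_0D[OF d_mem] by blast
  then have d0: "T (lin_fun (axis j 1)) z = \<alpha> * lin_fun (B' (axis j 1)) z" for j z
    by (simp add: d_def fun_eq_iff)
  have \<psi>_eq: "\<psi> z = B z" if z: "z \<in> unit_ball" for z
  proof (rule vec_eq_iff[THEN iffD2], rule allI)
    fix j
    have "\<alpha> * \<psi> z $ j = \<alpha> * hdot z (B' (axis j 1))"
      using T_lin[OF z, of "axis j 1"] d0[of j z] z by (simp add: hdot_axis lin_fun_def on_ball_def)
    also have "hdot z (B' (axis j 1)) = B z $ j"
      by (simp add: hdot_axis flip: B')
    finally show "\<psi> z $ j = B z $ j" using \<alpha> by simp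
  qed
  have T_lin_eq: "T (lin_fun a) = (\<lambda>x. \<alpha> * lin_fun (B' a) x)" for a
  proof
    fix z
    show "T (lin_fun a) z = \<alpha> * lin_fun (B' a) z"
      using T_lin[of z a] zero_off_ball[OF mem(1)[OF lin_mem], of z a]
      by (simp add: \<psi>_eq B' lin_fun_def on_ball_def)
  qed
  have T_scale: "T (\<lambda>x. c * h x) = (\<lambda>x. c * T h x)" "S (\<lambda>x. c * h x) = (\<lambda>x. c * S h x)"
    if "h \<in> H" for c h
    using T S that by (simp_all add: bounded_operator_def)
  \<comment> \<open>Commutation of \<open>T\<close> and \<open>S\<close> on \<open>lin_fun a\<close>
    equates the same nonzero multiple of \<open>lin_fun (B' (B a))\<close> and
    \<open>lin_fun (B (B' a))\<close>.\<close>
  have "B (B' a) = B' (B a)" for a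
  proof (rule lin_fun_inject[OF \<gamma>])
    have "(\<lambda>x. cnj \<alpha> * (\<alpha> * lin_fun (B' (B a)) x)) = (\<lambda>x. \<alpha> * (cnj \<alpha> * lin_fun (B (B' a)) x))"
      using comm[OF lin_mem[of a]] by (simp only: S_lin T_lin_eq T_scale lin_mem)
    then show "lin_fun (B (B' a)) = lin_fun (B' (B a))"
      using \<alpha> by (auto simp: fun_eq_iff)
  qed
  then have "normal_linear B"
    unfolding normal_linear_def using linB linB' B' by (auto simp: fun_eq_iff)
  moreover have "norm (B z) \<le> norm z" for z
    using self \<psi>_eq by (intro clinear_self_map_contraction[OF linB]) metis
  ultimately show ?thesis using \<psi>_eq by (rule that)
qed

lemma kern_eigenvector:
  assumes p: "p \<in> unit_ball" and fixed: "\<phi> p = p" and normal: "normal_operator H ip (wcomp f \<phi>)"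
  shows "wcomp f \<phi> (kern \<gamma> p) = (\<lambda>z. f p * kern \<gamma> p z)"
proof -
  have T: "bounded_operator H ip (wcomp f \<phi>)" using normal by (simp add: normal_operator_def)
  obtain S where S: "bounded_operator H ip S"
      and adj: "\<And>g h. g \<in> H \<Longrightarrow> h \<in> H \<Longrightarrow> ip (wcomp f \<phi> g) h = ip g (S h)"
      and comm: "\<And>h. h \<in> H \<Longrightarrow> wcomp f \<phi> (S h) = S (wcomp f \<phi> h)"
    using normal unfolding normal_operator_def by blast
  note K = kern_mem[OF p]
  have eig: "S (kern \<gamma> p) = (\<lambda>z. cnj (f p) * kern \<gamma> p z)"
  proof (rule ip_right_eqI)
    fix h assume h: "h \<in> H"
    have Th: "wcomp f \<phi> h \<in> H" using T h by (simp add: bounded_operator_def)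
    have "ip h (S (kern \<gamma> p)) = wcomp f \<phi> h p"
      using adj[OF h K] reproducing[OF Th p] by simp
    also have "\<dots> = f p * ip h (kern \<gamma> p)"
      using p fixed by (simp add: wcomp_def on_ball_def reproducing[OF h p])
    finally show "ip h (S (kern \<gamma> p)) = ip h (\<lambda>z. cnj (f p) * kern \<gamma> p z)"
      using h K by (simp add: ip_scale_right)
  qed (use S K in \<open>simp_all add: bounded_operator_def scale_mem\<close>)
  show ?thesis
    by (rule normal_eigenvector_adjoint[OF T S adj comm K eig])
qed

end

theorem theorem4p3:
  fixes \<gamma> :: real
    and H :: "(complex ^ 'n \<Rightarrow> complex) set"
    and ip :: "(complex ^ 'n \<Rightarrow> complex) \<Rightarrow> (complex ^ 'n \<Rightarrow> complex) \<Rightarrow> complex"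
    and f :: "complex ^ 'n \<Rightarrow> complex"
    and \<phi> :: "complex ^ 'n \<Rightarrow> complex ^ 'n"
    and p :: "complex ^ 'n"
  assumes "\<gamma> > 0"
    and "kernel_space \<gamma> H ip"
    and "analytic_on_ball f"
    and "analytic_self_map \<phi>"
    and "p \<in> ball 0 1"
    and "\<phi> p = p"
  shows "(normal_operator H ip (wcomp f \<phi>) \<and> (\<exists>h\<in>H. wcomp f \<phi> h \<noteq> (\<lambda>_. 0)) \<longrightarrow>
           (\<exists>\<alpha> A. \<alpha> \<noteq> 0 \<and> normal_linear A \<and> onorm A \<le> 1 \<and> moebius_linear_form \<gamma> p f \<phi> \<alpha> A))
       \<and> (\<forall>\<alpha> A. \<alpha> \<noteq> 0 \<and> normal_linear A \<and> onorm A \<le> 1 \<and> moebius_linear_form \<gamma> p f \<phi> \<alpha> A \<longrightarrow>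
            \<alpha> = f p
            \<and> normal_operator H ip (\<lambda>h z. f p * comp_op A h z)
            \<and> unitarily_equivalent H ip (wcomp f \<phi>) (\<lambda>h z. f p * comp_op A h z)
            \<and> (\<forall>h\<in>H. wcomp f \<phi> h =
                 moebius_op \<gamma> p (\<lambda>z. f p * comp_op A (moebius_op \<gamma> p h) z))
            \<and> normal_operator H ip (wcomp f \<phi>))"
proof -
  interpret kernel_space \<gamma> H ip by fact
  note \<gamma> = \<open>\<gamma> > 0\<close> and p = \<open>p \<in> ball 0 1\<close> and fixed = \<open>\<phi> p = p\<close>
  have self: "\<phi> z \<in> unit_ball" if "z \<in> unit_ball" for z
    using assms(4) that by (simp add: analytic_self_map_def)
  note m = moebius_in_ball[OF p] and mm = moebius_moebius[OF p]
  let ?U = "moebius_op \<gamma> p"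
  note U_mem = moebius_op_contraction(1)[OF p] and UU = moebius_op_moebius_op[OF p]
  note conjugate = normal_operator_conjugate[OF _ bounded_moebius_op[OF p] moebius_op_adjoint[OF p] UU]
  have "\<exists>\<alpha> A. \<alpha> \<noteq> 0 \<and> normal_linear A \<and> onorm A \<le> 1 \<and> moebius_linear_form \<gamma> p f \<phi> \<alpha> A"
    if normal: "normal_operator H ip (wcomp f \<phi>)" and nonzero: "\<exists>h\<in>H. wcomp f \<phi> h \<noteq> (\<lambda>_. 0)"
  proof -
    have f_eq: "f z = f p * (nkern \<gamma> p z / nkern \<gamma> p (\<phi> z))" if z: "z \<in> unit_ball" for z
    proof -
      have "f z * nkern \<gamma> p (\<phi> z) = f p * nkern \<gamma> p z"
        using fun_cong[OF kern_eigenvector[OF p fixed normal], of z] z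
        by (simp add: wcomp_def on_ball_def nkern_eq_kern)
      then show ?thesis
        using nkern_nonzero[OF p self[OF z], of \<gamma>] by (simp add: field_simps)
    qed
    \<comment> \<open>By \<open>f_eq\<close> every value of \<open>f\<close> on the ball is a
      multiple of \<open>f p\<close>, so a zero at \<open>p\<close> would make the operator
      zero.\<close>
    have fp: "f p \<noteq> 0"
    proof
      assume "f p = 0"
      then have "wcomp f \<phi> h = (\<lambda>_. 0)" for h
        using f_eq by (auto simp: wcomp_def on_ball_def fun_eq_iff)
      then show False using nonzero by simp
    qed
    define \<psi> where "\<psi> z = moebius p (\<phi> (moebius p z))" for z
    have \<psi>_self: "\<psi> z \<in> unit_ball" if "z \<in> unit_ball" for z
      unfolding \<psi>_def using that by (intro m self)
    \<comment> \<open>The denominator of \<open>f\<close> at \<open>moebius p z\<close> cancels the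
      weight of the inner \<open>?U\<close>; the remaining weights at \<open>z\<close> and
      \<open>moebius p z\<close> multiply to 1.\<close>
    have T_eq: "?U (wcomp f \<phi> (?U h)) z = f p * h (\<psi> z)" if h: "h \<in> H" and z: "z \<in> unit_ball" for h z
    proof -
      have "?U (wcomp f \<phi> (?U h)) z =
          nkern \<gamma> p z * (f (moebius p z) * (nkern \<gamma> p (\<phi> (moebius p z)) * h (\<psi> z)))"
        using m[OF z] self[OF m[OF z]] z
        by (simp add: moebius_op_def wcomp_def on_ball_def \<psi>_def)
      also have "\<dots> = f p * (nkern \<gamma> p z * nkern \<gamma> p (moebius p z)) * h (\<psi> z)"
        using nkern_nonzero[OF p self[OF m[OF z]], of \<gamma>] unfolding f_eq[OF m[OF z]] by simp
      finally show ?thesis by (simp add: nkern_mult_moebius[OF p z])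
    qed
    have "\<psi> 0 = 0"
      by (simp add: \<psi>_def moebius_zero[OF p] fixed moebius_self[OF p])
    then obtain B where B: "normal_linear B" "\<And>z. norm (B z) \<le> norm z"
        and \<psi>_eq: "\<And>z. z \<in> unit_ball \<Longrightarrow> \<psi> z = B z"
      using normal_composition_linear[OF \<gamma> conjugate[OF normal] fp T_eq \<psi>_self] by blast
    have "\<phi> z = moebius p (B (moebius p z))" if z: "z \<in> unit_ball" for z
      by (simp only: \<psi>_def mm[OF z] mm[OF self[OF z]] flip: \<psi>_eq[OF m[OF z]])
    then have "moebius_linear_form \<gamma> p f \<phi> (f p) B"
      using f_eq by (simp add: moebius_linear_form_def)
    moreover have "onorm B \<le> 1"
      using B(2) by (intro onorm_le) simp
    ultimately show ?thesis using fp B(1) by blast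
  qed
  moreover have "\<alpha> = f p
      \<and> normal_operator H ip (\<lambda>h z. f p * comp_op A h z)
      \<and> unitarily_equivalent H ip (wcomp f \<phi>) (\<lambda>h z. f p * comp_op A h z)
      \<and> (\<forall>h\<in>H. wcomp f \<phi> h = ?U (\<lambda>z. f p * comp_op A (?U h) z))
      \<and> normal_operator H ip (wcomp f \<phi>)"
    if A: "normal_linear A" and onorm_A: "onorm A \<le> 1" and form: "moebius_linear_form \<gamma> p f \<phi> \<alpha> A" for \<alpha> A
  proof -
    have contr: "norm (A x) \<le> norm x" for x
    proof -
      have "norm (A x) \<le> onorm A * norm x"
        using A by (intro onorm[OF clinear_imp_bounded_linear]) (simp add: normal_linear_def)
      also have "\<dots> \<le> 1 * norm x"
        using onorm_A by (intro mult_right_mono) auto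
      finally show ?thesis by simp
    qed
    then have A_self: "A z \<in> unit_ball" if "z \<in> unit_ball" for z
      using that le_less_trans[OF contr[of z]] by simp
    \<comment> \<open>At the fixed point the quotient of normalized kernels is 1.\<close>
    have \<alpha>: "\<alpha> = f p"
      using form p fixed nkern_nonzero[OF p p, of \<gamma>] by (simp add: moebius_linear_form_def)
    have N: "normal_operator H ip (\<lambda>h z. f p * comp_op A h z)"
      using \<gamma> A contr by (rule normal_comp_op)
    have W_eq: "wcomp f \<phi> h = ?U (\<lambda>z. f p * comp_op A (?U h) z)" for h
    proof
      fix z
      show "wcomp f \<phi> h z = ?U (\<lambda>z. f p * comp_op A (?U h) z) z"
      proof (cases "z \<in> unit_ball")
        case True
        then show ?thesis
          using form unfolding moebius_linear_form_def \<alpha>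
          by (subst moebius_conjugate_eq[OF p A_self True]) (simp_all add: wcomp_def on_ball_def)
      qed (simp add: moebius_op_def wcomp_def on_ball_def)
    qed
    \<comment> \<open>This also yields boundedness of \<open>wcomp f \<phi>\<close>, which in this
      direction is a conclusion.\<close>
    have "normal_operator H ip (wcomp f \<phi>)"
      using conjugate[OF N] W_eq by (rule normal_operator_cong)
    moreover have "unitarily_equivalent H ip (wcomp f \<phi>) (\<lambda>h z. f p * comp_op A h z)"
      unfolding unitarily_equivalent_def
      by (rule exI[of _ ?U]) (simp add: unitary_moebius_op[OF p] W_eq UU)
    ultimately show ?thesis using \<alpha> N W_eq by blast
  qed
  ultimately show ?thesis by blast
qed

end
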